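(* Let $x\in\mathcal A_\alpha$ for some $\alpha>0$ (with constants $B_1,B_2>0$, $\rho\ge 0$, $\triangle>0$), and let $\mathfrak S_x(t,\eta,\lambda)$ be the chirplet transform of $x$ with an admissible window function $g$ (with support contained in $[-N,N]$ and constants $C$, $L=\max(1,\sqrt\rho)\,C$) and parameter $\sigma$. Let $\sigma=\frac{c_0}{\alpha^2}$ for some $c_0>0$. For $t\in\mathbb R$ let $\mu=\mu(t)=\min_{0\le k\le K}|A_k(t)|$ and $M=M(t)=\sum_{k=0}^K|A_k(t)|$. If $$\alpha\le \min\Big\{\frac{\mu}{4Mc_0N\big(B_1+\frac{\pi}{3}B_2c_0^2N^2\big)},\ \frac{\mu\sqrt{c_0\triangle}}{4ML}\Big\},$$ then the following statements hold. (a) The set $\mathcal G(t)=\{(\eta,\lambda): |\mathfrak S_x(t,\eta,\lambda)|\ge \mu/2\}$ can be expressed as a disjoint union of exactly $K+1$ non-empty sets $$\mathcal G_\ell(t)=\Big\{(\eta,\lambda)\in\mathcal G(t): \sigma|\eta-\phi_\ell'(t)|+\rho\sigma^2|\lambda-\phi_\ell''(t)|\le\Big(\frac{4LM}{\mu}\Big)^2\Big\},\qquad \ell=0,\dots,K.$$ (b) For each $t$, let $$(\widehat\eta_\ell(t),\widehat\lambda_\ell(t))=\operatorname{argmax}_{(\eta,\lambda)\in\mathcal G_\ell(t)}|\mathfrak S_x(t,\eta,\lambda)|,\qquad \ell=0,\dots,K.$$ Then $$\Big||\mathfrak S_x(t,\widehat\eta_\ell(t),\widehat\lambda_\ell(t))|-A_\ell(t)\Big|\le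 \alpha M\Big(\frac{L}{\sqrt{c_0\triangle}}+c_0NB_1+\frac{\pi}{3}B_2c_0^3N^3\Big),$$ $$|\widehat\eta_\ell(t)-\phi_\ell'(t)|=\frac1\sigma o(1)=\alpha^2o(1),$$ $$|\widehat\lambda_\ell(t)-\phi_\ell''(t)|=\frac1{\sigma^2}o(1)=\alpha^4o(1),$$ $$\big|\mathfrak S_x(t,\widehat\eta_\ell(t),\widehat\lambda_\ell(t))-x_\ell(t)\big|\le o(1)+\alpha M\Big(\frac{L}{\sqrt{c_0\triangle}}+c_0NB_1+\frac{\pi}{3}B_2c_0^3N^3\Big),$$ as $\alpha\to0^+$.
   Context: Class $\mathcal A_\alpha$. For $\alpha>0$, $\mathcal A_\alpha$ is the set of functions $$x(t)=A_0(t)+\sum_{k=1}^Kx_k(t)=\sum_{k=0}^KA_k(t)e^{i2\pi\phi_k(t)},\qquad x_k(t)=A_k(t)e^{i2\pi\phi_k(t)},$$ with $\phi_0\equiv0$ (so $x_0=A_0$), $A_k\in L_\infty(\mathbb R)$, $A_k(t)>0$, $\phi_k\in C^3(\mathbb R)$ for $0\le k\le K$, $\inf_{t\in\mathbb R}\phi_k'(t)>0$ and $\sup_{t\in\mathbb R}\phi_k'(t)<\infty$ for $1\le k\le K$, such that for $k=0,\dots,K$ $$|A_k(t+\tau)-A_k(t)|\le\alpha^3B_1|\tau|A_k(t),\qquad \sup_{t\in\mathbb R}|\phi_k'''(t)|\le\alpha^7B_2,$$ where $B_1,B_2$ are some positive constants independent of $\alpha$, and such that, for some $\rho\ge0$ and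 $\triangle>0$, $$|\phi_k'(t)-\phi_\ell'(t)|+\rho|\phi_k''(t)-\phi_\ell''(t)|\ge2\triangle\qquad (k\ne\ell).$$ Polynomial Fourier transform. For $g\in L_1(\mathbb R)$, $\breve g(\eta,\lambda)=\int_{\mathbb R}g(\tau)e^{-i2\pi\eta\tau-i\pi\lambda\tau^2}d\tau$. Admissible window. A function $g(t)\ge0$ is called an admissible window function if $\int_{\mathbb R}g(t)dt=1$, $\operatorname{supp}(g)\subseteq[-N,N]$ for some $N>0$, and: (a) there exists a constant $C$ such that $|\breve g(\eta,\lambda)|\le C/\sqrt{|\eta|+|\lambda|}$ for all $\eta,\lambda\in\mathbb R$; (b) if there exists a constant $D$ such that $1-|\breve g(\eta,\lambda)|\le D\varepsilon$ holds for sufficiently small $\varepsilon>0$ and $(\eta,\lambda)$ in the neighborhood of $(0,0)$, then $\eta$ and $\lambda$ must satisfy $|\eta|=o(1)$ and $|\lambda|=o(1)$ as $\varepsilon\to0$. With $L=\max(1,\sqrt\rho)\,C$, where $\rho$ is the number in the separation condition above, one has $|\breve g(\eta,\lambda)|\le L/\sqrt{|\eta|+\rho|\lambda|}$ for all $\eta,\lambda\in\mathbb R$. Chirplet transform. With window $g$ and $\sigma>0$, $$\mathfrak S_x(t,\eta,\lambda)=\int_{\mathbb R}x(t+\tau)\frac1\sigma g\Big(\frac\tau\sigma\Big)e^{-i2\pi\eta\tau-i\pi\lambda\tau^2}d\tau .$$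
   Formalization: If ρ>0, part (a) and the amplitude estimate in (b) also assume σ≥1 (i.e. α²≤c_0); without it the sets G_ℓ(t) can overlap. The o(1) terms are uniform over signals and t with μ(t)≥μ_0>0 and M(t)≤M_0, for each fixed μ_0 and M_0. *)

theory Defs
  imports "HOL-Analysis.Analysis" "HOL-Library.Landau_Symbols"
begin

definition C3 :: "(real \<Rightarrow> real) \<Rightarrow> bool" where
  "C3 f \<longleftrightarrow>
     f differentiable_on UNIV \<and> deriv f differentiable_on UNIV \<and>
     deriv (deriv f) differentiable_on UNIV \<and> continuous_on UNIV (deriv (deriv (deriv f)))"

definition L_infinity :: "(real \<Rightarrow> real) \<Rightarrow> bool" where
  "L_infinity f \<longleftrightarrow> f \<in> borel_measurable lebesgue \<and> (\<exists>c. AE t in lebesgue. \<bar>f t\<bar> \<le> c)"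

definition component :: "(nat \<Rightarrow> real \<Rightarrow> real) \<Rightarrow> (nat \<Rightarrow> real \<Rightarrow> real) \<Rightarrow> nat \<Rightarrow> real \<Rightarrow> complex" where
  "component A \<phi> k t = of_real (A k t) * cis (2 * pi * \<phi> k t)"

text \<open>
  \<open>class_A \<alpha> B1 B2 \<rho> \<Delta> x K A \<phi>\<close> says that \<open>x\<close> belongs to the class \<open>A_\<alpha>\<close>, with constants
  \<open>B1\<close>, \<open>B2\<close>, \<open>\<rho>\<close>, \<open>\<Delta>\<close>, through the decomposition given by \<open>K\<close>, \<open>A\<close> and \<open>\<phi>\<close>. The
  decomposition is an argument because the amplitudes and phases occur in all the conclusions.
  The conditions on infima and suprema are written pointwise, since \<open>Inf\<close> and \<open>Sup\<close> of
  unbounded sets of reals are unspecified.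
\<close>

definition class_A ::
  "real \<Rightarrow> real \<Rightarrow> real \<Rightarrow> real \<Rightarrow> real \<Rightarrow> (real \<Rightarrow> complex) \<Rightarrow>
   nat \<Rightarrow> (nat \<Rightarrow> real \<Rightarrow> real) \<Rightarrow> (nat \<Rightarrow> real \<Rightarrow> real) \<Rightarrow> bool" where
  "class_A \<alpha> B1 B2 \<rho> \<Delta> x K A \<phi> \<longleftrightarrow>
     (\<forall>t. x t = (\<Sum>k\<le>K. component A \<phi> k t)) \<and>
     (\<forall>t. \<phi> 0 t = 0) \<and>
     (\<forall>k\<le>K. L_infinity (A k) \<and> (\<forall>t. A k t > 0) \<and> C3 (\<phi> k)) \<and>
     (\<forall>k\<in>{1..K}. (\<exists>c>0. \<forall>t. c \<le> deriv (\<phi> k) t) \<and> (\<exists>c. \<forall>t. deriv (\<phi> k) t \<le> c)) \<and>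
     (\<forall>k\<le>K. \<forall>t \<tau>. \<bar>A k (t + \<tau>) - A k t\<bar> \<le> \<alpha> ^ 3 * B1 * \<bar>\<tau>\<bar> * A k t) \<and>
     (\<forall>k\<le>K. \<forall>t. \<bar>deriv (deriv (deriv (\<phi> k))) t\<bar> \<le> \<alpha> ^ 7 * B2) \<and>
     (\<forall>k\<le>K. \<forall>l\<le>K. k \<noteq> l \<longrightarrow>
        (\<forall>t. \<bar>deriv (\<phi> k) t - deriv (\<phi> l) t\<bar>
              + \<rho> * \<bar>deriv (deriv (\<phi> k)) t - deriv (deriv (\<phi> l)) t\<bar> \<ge> 2 * \<Delta>))"

definition poly_fourier :: "(real \<Rightarrow> complex) \<Rightarrow> real \<Rightarrow> real \<Rightarrow> complex" where
  "poly_fourier f \<eta> \<kappa> =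
     (LINT \<tau>|lebesgue. f \<tau> * cis (- (2 * pi * \<eta> * \<tau>) - pi * \<kappa> * \<tau>\<^sup>2))"

text \<open>
  The chirp rate is called \<open>\<kappa>\<close> because \<open>\<lambda>\<close> is not available as a variable name.
  In the decay condition the origin is excluded explicitly: there the bound is \<open>C / 0\<close>, which
  is no restriction on paper but equals 0 in HOL. The last condition reads the requirement near
  \<open>(0,0)\<close> as a statement about all families \<open>(\<eta> \<epsilon>, \<kappa> \<epsilon>)\<close> that stay in a fixed
  neighbourhood \<open>U\<close> of \<open>(0,0)\<close>.
\<close>

definition admissible_window :: "(real \<Rightarrow> real) \<Rightarrow> real \<Rightarrow> real \<Rightarrow> bool" where
  "admissible_window g N C \<longleftrightarrow>
     (\<forall>\<tau>. g \<tau> \<ge> 0) \<and> integrable lebesgue g \<and> (LINT \<tau>|lebesgue. g \<tau>) = 1 \<and>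
     N > 0 \<and> closure {\<tau>. g \<tau> \<noteq> 0} \<subseteq> {-N..N} \<and>
     (\<forall>\<eta> \<kappa>. (\<eta>, \<kappa>) \<noteq> (0, 0) \<longrightarrow>
        cmod (poly_fourier (\<lambda>\<tau>. of_real (g \<tau>)) \<eta> \<kappa>) \<le> C / sqrt (\<bar>\<eta>\<bar> + \<bar>\<kappa>\<bar>)) \<and>
     (\<exists>U. open U \<and> (0, 0) \<in> U \<and>
        (\<forall>D \<eta> \<kappa>.
           (\<forall>\<^sub>F \<epsilon> in at_right 0. (\<eta> \<epsilon>, \<kappa> \<epsilon>) \<in> U \<and>
              1 - cmod (poly_fourier (\<lambda>\<tau>. of_real (g \<tau>)) (\<eta> \<epsilon>) (\<kappa> \<epsilon>)) \<le> D * \<epsilon>)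
           \<longrightarrow> \<eta> \<in> o[at_right (0::real)](\<lambda>_. 1 :: real) \<and>
               \<kappa> \<in> o[at_right (0::real)](\<lambda>_. 1 :: real)))"

definition chirplet ::
  "(real \<Rightarrow> real) \<Rightarrow> real \<Rightarrow> (real \<Rightarrow> complex) \<Rightarrow> real \<Rightarrow> real \<Rightarrow> real \<Rightarrow> complex" where
  "chirplet g \<sigma> x t \<eta> \<kappa> =
     (LINT \<tau>|lebesgue. x (t + \<tau>) * of_real (1 / \<sigma> * g (\<tau> / \<sigma>))
                        * cis (- (2 * pi * \<eta> * \<tau>) - pi * \<kappa> * \<tau>\<^sup>2))"

definition amp_min :: "nat \<Rightarrow> (nat \<Rightarrow> real \<Rightarrow> real) \<Rightarrow> real \<Rightarrow> real" where
  "amp_min K A t = Min ((\<lambda>k. \<bar>A k t\<bar>) ` {..K})"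

definition amp_sum :: "nat \<Rightarrow> (nat \<Rightarrow> real \<Rightarrow> real) \<Rightarrow> real \<Rightarrow> real" where
  "amp_sum K A t = (\<Sum>k\<le>K. \<bar>A k t\<bar>)"

definition window_L :: "real \<Rightarrow> real \<Rightarrow> real" where
  "window_L \<rho> C = max 1 (sqrt \<rho>) * C"

definition alpha_max ::
  "real \<Rightarrow> real \<Rightarrow> real \<Rightarrow> real \<Rightarrow> real \<Rightarrow> real \<Rightarrow> real \<Rightarrow> real \<Rightarrow> real" where
  "alpha_max c0 N B1 B2 \<Delta> L \<mu> M =
     min (\<mu> / (4 * M * c0 * N * (B1 + pi / 3 * B2 * c0\<^sup>2 * N\<^sup>2)))
         (\<mu> * sqrt (c0 * \<Delta>) / (4 * M * L))"

definition err_bound ::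
  "real \<Rightarrow> real \<Rightarrow> real \<Rightarrow> real \<Rightarrow> real \<Rightarrow> real \<Rightarrow> real \<Rightarrow> real \<Rightarrow> real" where
  "err_bound c0 N B1 B2 \<Delta> L \<alpha> M =
     \<alpha> * M * (L / sqrt (c0 * \<Delta>) + c0 * N * B1 + pi / 3 * B2 * c0 ^ 3 * N ^ 3)"

definition G_set ::
  "(real \<Rightarrow> real) \<Rightarrow> real \<Rightarrow> (real \<Rightarrow> complex) \<Rightarrow> nat \<Rightarrow> (nat \<Rightarrow> real \<Rightarrow> real) \<Rightarrow> real \<Rightarrow> (real \<times> real) set" where
  "G_set g \<sigma> x K A t = {(\<eta>, \<kappa>). cmod (chirplet g \<sigma> x t \<eta> \<kappa>) \<ge> amp_min K A t / 2}"

definition G_comp ::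
  "(real \<Rightarrow> real) \<Rightarrow> real \<Rightarrow> real \<Rightarrow> real \<Rightarrow> (real \<Rightarrow> complex) \<Rightarrow> nat \<Rightarrow> (nat \<Rightarrow> real \<Rightarrow> real) \<Rightarrow>
   (nat \<Rightarrow> real \<Rightarrow> real) \<Rightarrow> real \<Rightarrow> nat \<Rightarrow> (real \<times> real) set" where
  "G_comp g \<sigma> \<rho> L x K A \<phi> t l =
     {(\<eta>, \<kappa>) \<in> G_set g \<sigma> x K A t.
        \<sigma> * \<bar>\<eta> - deriv (\<phi> l) t\<bar> + \<rho> * \<sigma>\<^sup>2 * \<bar>\<kappa> - deriv (deriv (\<phi> l)) t\<bar>
          \<le> (4 * L * amp_sum K A t / amp_min K A t)\<^sup>2}"

text \<open>The maximiser need not be unique, so \<open>argmax\<close> is rendered as a predicate.\<close>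

definition is_ridge_point ::
  "(real \<Rightarrow> real) \<Rightarrow> real \<Rightarrow> real \<Rightarrow> real \<Rightarrow> (real \<Rightarrow> complex) \<Rightarrow> nat \<Rightarrow> (nat \<Rightarrow> real \<Rightarrow> real) \<Rightarrow>
   (nat \<Rightarrow> real \<Rightarrow> real) \<Rightarrow> real \<Rightarrow> nat \<Rightarrow> real \<Rightarrow> real \<Rightarrow> bool" where
  "is_ridge_point g \<sigma> \<rho> L x K A \<phi> t l \<eta> \<kappa> \<longleftrightarrow>
     is_arg_max (\<lambda>(\<eta>', \<kappa>'). cmod (chirplet g \<sigma> x t \<eta>' \<kappa>'))
       (\<lambda>p. p \<in> G_comp g \<sigma> \<rho> L x K A \<phi> t l) (\<eta>, \<kappa>)"

end

theory Submission
  imports Defs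
begin

text \<open>
  Rescaling \<open>\<tau> = \<sigma> s\<close> and Taylor expansion of amplitudes and phases give
  \<open>S(\<eta>, \<kappa>) \<approx> \<Sum>\<^sub>k x\<^sub>k(t) ghat(\<sigma>(\<eta> - \<phi>\<^sub>k'), \<sigma>\<^sup>2(\<kappa> - \<phi>\<^sub>k''))\<close>, where \<open>ghat\<close> is the polynomial
  Fourier transform of the window. By the separation condition and the decay of \<open>ghat\<close>, near the
  \<open>l\<close>-th ridge all terms but the \<open>l\<close>-th are negligible, which yields (a) and the amplitude estimate.
  At a ridge point, then, \<open>1 - |ghat| = O(\<alpha>)\<close>. Since \<open>|ghat| < 1\<close> off the origin (a quadratic phase
  has countable level sets) and \<open>ghat\<close> decays, compactness forces the argument of \<open>ghat\<close> to tend to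
  zero with \<open>\<alpha>\<close>, at a rate that depends on the window only.
\<close>

section \<open>Elementary facts about unimodular phases\<close>

lemma norm_cis_diff_le: "cmod (cis a - cis b) \<le> \<bar>a - b\<bar>"
proof -
  have "cis a - cis b = cis b * (exp (\<i> * of_real (a - b)) - 1)"
    unfolding cis_conv_exp[symmetric] by (simp add: algebra_simps cis_mult)
  then have "cmod (cis a - cis b) = 2 * \<bar>sin ((a - b) / 2)\<bar>"
    by (metis norm_mult norm_cis mult_1 dist_exp_i_1)
  also have "\<dots> \<le> \<bar>a - b\<bar>"
    using abs_sin_x_le_abs_x[of "(a - b) / 2"] by simp
  finally show ?thesis .
qed

text \<open>The phase must lie in \<open>Arg u + 2 * pi * n\<close> for an integer \<open>n\<close>,
  and for each \<open>n\<close> this is a nonzero polynomial equation with finitely many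
  roots.\<close>

lemma countable_quadratic_phase_level_set:
  fixes a b :: real
  assumes "(a, b) \<noteq> (0, 0)"
  shows "countable {s. cis (a * s + b * s\<^sup>2) = u}"
proof -
  have "{s. cis (a * s + b * s\<^sup>2) = u} \<subseteq> (\<Union>n::int. {s. a * s + b * s\<^sup>2 = Arg u + 2 * pi * n})"
  proof
    fix s assume "s \<in> {s. cis (a * s + b * s\<^sup>2) = u}"
    then have u: "cis (a * s + b * s\<^sup>2) = u" by simp
    then have "cis (Arg u) = cis (a * s + b * s\<^sup>2)"
      by (metis cis_Arg_unique Arg_correct norm_cis norm_zero zero_neq_one sgn_eq div_by_1 of_real_1)
    then have "cos (a * s + b * s\<^sup>2) = cos (Arg u)" "sin (a * s + b * s\<^sup>2) = sin (Arg u)"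
      by (simp_all add: complex_eq_iff)
    then show "s \<in> (\<Union>n::int. {s. a * s + b * s\<^sup>2 = Arg u + 2 * pi * n})"
      using sin_cos_eq_iff by auto
  qed
  moreover have "finite {s. a * s + b * s\<^sup>2 = c}" for c
  proof -
    have "[:-c, a, b:] \<noteq> 0" using assms by auto
    from poly_roots_finite[OF this] show ?thesis
      by (rule rev_finite_subset) (auto simp: power2_eq_square algebra_simps)
  qed
  then have "countable (\<Union>n::int. {s. a * s + b * s\<^sup>2 = Arg u + 2 * pi * n})"
    by (intro countable_UN countableI_type countable_finite)
  ultimately show ?thesis by (rule countable_subset)
qed

section \<open>The polynomial Fourier transform of a window\<close>

locale window =
  fixes g :: "real \<Rightarrow> real" and N C :: real
  assumes N_pos: "N > 0"
    and nonneg: "g s \<ge> 0"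
    and integrable: "integrable lebesgue g"
    and integral: "(LINT s|lebesgue. g s) = 1"
    and support: "g s \<noteq> 0 \<Longrightarrow> \<bar>s\<bar> \<le> N"
    and decay: "(\<eta>, \<kappa>) \<noteq> (0, 0) \<Longrightarrow>
      cmod (poly_fourier (\<lambda>\<tau>. of_real (g \<tau>)) \<eta> \<kappa>) \<le> C / sqrt (\<bar>\<eta>\<bar> + \<bar>\<kappa>\<bar>)"
begin

section \<open>Integration against the window\<close>

text \<open>A continuous factor is bounded on \<open>{-N..N}\<close>, outside of which
  \<open>g\<close> vanishes, so a multiple of \<open>g\<close> dominates the product.\<close>

lemma integrable_scaleR:
  fixes f :: "real \<Rightarrow> 'a::euclidean_space"
  assumes "continuous_on UNIV f"
  shows "integrable lebesgue (\<lambda>s. g s *\<^sub>R f s)"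
proof -
  have "compact (f ` {-N..N})"
    by (intro compact_continuous_image continuous_on_subset[OF assms]) auto
  then obtain B where B: "norm (f s) \<le> B" if "s \<in> {-N..N}" for s
    using compact_imp_bounded bounded_iff by (metis imageI)
  have f: "f \<in> borel_measurable lebesgue"
    using borel_measurable_continuous_onI[OF assms] by (simp add: measurable_completion)
  show ?thesis
  proof (rule Bochner_Integration.integrable_bound)
    show "integrable lebesgue (\<lambda>s. B * g s)" using integrable by simp
    show "(\<lambda>s. g s *\<^sub>R f s) \<in> borel_measurable lebesgue"
      using f borel_measurable_integrable[OF integrable] by measurable
    show "AE s in lebesgue. norm (g s *\<^sub>R f s) \<le> norm (B * g s)"
    proof (rule AE_I2)
      fix s
      show "norm (g s *\<^sub>R f s) \<le> norm (B * g s)"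
      proof (cases "g s = 0")
        case False
        then have "norm (f s) \<le> \<bar>B\<bar>" using support[of s] B[of s] by force
        then show ?thesis using mult_left_mono[OF _ nonneg[of s], of "norm (f s)" "\<bar>B\<bar>"] nonneg[of s]
          by (simp add: abs_mult mult.commute)
      qed auto
    qed
  qed
qed

lemma integrable_mult:
  fixes h :: "real \<Rightarrow> real"
  shows "continuous_on UNIV h \<Longrightarrow> integrable lebesgue (\<lambda>s. g s * h s)"
  using integrable_scaleR[of h] by simp

lemma norm_integral_le:
  fixes f :: "real \<Rightarrow> 'a::euclidean_space"
  assumes "continuous_on UNIV f" "continuous_on UNIV h"
    and "\<And>s. \<bar>s\<bar> \<le> N \<Longrightarrow> norm (f s) \<le> h s"
  shows "norm (LINT s|lebesgue. g s *\<^sub>R f s) \<le> (LINT s|lebesgue. g s * h s)"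
proof (rule Bochner_Integration.integral_norm_bound_integral)
  fix s show "norm (g s *\<^sub>R f s) \<le> g s * h s"
    using assms(3)[of s] support[of s] nonneg[of s]
    by (cases "g s = 0") (auto intro: mult_left_mono)
qed (use assms integrable_scaleR integrable_mult in auto)

lemma norm_integral_le_const:
  fixes f :: "real \<Rightarrow> 'a::euclidean_space"
  assumes "continuous_on UNIV f" and "\<And>s. \<bar>s\<bar> \<le> N \<Longrightarrow> norm (f s) \<le> b"
  shows "norm (LINT s|lebesgue. g s *\<^sub>R f s) \<le> b"
  using norm_integral_le[OF assms(1), of "\<lambda>_. b"] assms(2) integral by simp

text \<open>Countable sets are Lebesgue null, so otherwise \<open>g\<close> would vanish almost
  everywhere and could not have integral 1.\<close>

lemma not_AE_zero_off_countable:
  assumes "countable Z"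
  shows "\<not> (AE s in lebesgue. g s = 0 \<or> s \<in> Z)"
proof
  assume "AE s in lebesgue. g s = 0 \<or> s \<in> Z"
  moreover have "AE s in lebesgue. s \<notin> Z"
    by (rule AE_not_in[OF null_sets_completionI[OF countable_imp_null_set_lborel[OF assms]]])
  ultimately have "AE s in lebesgue. g s = 0" by eventually_elim auto
  then show False using integral integral_eq_zero_AE[of g lebesgue] by simp
qed

text \<open>The source of every strict inequality below: if the integral of the nonnegative product
  were zero, \<open>g\<close> would vanish almost everywhere off the countable zero set of
  \<open>h\<close>.\<close>

lemma integral_pos:
  fixes h :: "real \<Rightarrow> real"
  assumes cont: "continuous_on UNIV h" and h: "\<And>s. \<bar>s\<bar> \<le> N \<Longrightarrow> h s \<ge> 0"
    and Z: "countable {s. \<bar>s\<bar> \<le> N \<and> h s = 0}"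
  shows "(LINT s|lebesgue. g s * h s) > 0"
proof -
  have nn: "g s * h s \<ge> 0" for s
    using h[of s] support[of s] nonneg[of s] by (cases "g s = 0") auto
  have "(LINT s|lebesgue. g s * h s) \<noteq> 0"
  proof
    assume "(LINT s|lebesgue. g s * h s) = 0"
    then have "AE s in lebesgue. g s * h s = 0"
      using nn integral_nonneg_eq_0_iff_AE[OF integrable_mult[OF cont]] by auto
    then have "AE s in lebesgue. g s = 0 \<or> s \<in> {s. \<bar>s\<bar> \<le> N \<and> h s = 0}"
      by eventually_elim (use support in auto)
    then show False using not_AE_zero_off_countable[OF Z] by blast
  qed
  moreover have "(LINT s|lebesgue. g s * h s) \<ge> 0" using nn by simp
  ultimately show ?thesis by simp
qed

section \<open>The transform with a window of unit scale and its continuity\<close>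

text \<open>Common form of the chirplet transform after rescaling to \<sigma> = 1 and of the
  polynomial Fourier transform of \<open>g\<close> (the case \<open>X = 1\<close>), so that one
  continuity argument serves both.\<close>

definition wft :: "(real \<Rightarrow> complex) \<Rightarrow> real \<Rightarrow> real \<Rightarrow> complex" where
  "wft X \<eta> \<kappa> = (LINT s|lebesgue. g s *\<^sub>R (X s * cis (- (2 * pi * \<eta> * s) - pi * \<kappa> * s\<^sup>2)))"

abbreviation ghat :: "real \<Rightarrow> real \<Rightarrow> complex" where
  "ghat \<equiv> wft (\<lambda>_. 1)"

lemma ghat_eq: "ghat \<eta> \<kappa> = poly_fourier (\<lambda>\<tau>. of_real (g \<tau>)) \<eta> \<kappa>"
  by (simp add: wft_def poly_fourier_def scaleR_conv_of_real)

lemma integrable_wft: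
  assumes "continuous_on UNIV X"
  shows "integrable lebesgue (\<lambda>s. g s *\<^sub>R (X s * cis (- (2 * pi * \<eta> * s) - pi * \<kappa> * s\<^sup>2)))"
  by (intro integrable_scaleR continuous_intros assms)

text \<open>Substitute \<tau> = \<sigma> s: the Jacobian cancels the factor
  \<open>1 / \<sigma>\<close> of the window, and the chirp rate, which multiplies \<tau> squared,
  picks up \<open>\<sigma>\<^sup>2\<close>.\<close>

lemma chirplet_eq_wft:
  assumes "\<sigma> > 0"
  shows "chirplet g \<sigma> x t \<eta> \<kappa> = wft (\<lambda>s. x (t + \<sigma> * s)) (\<sigma> * \<eta>) (\<sigma>\<^sup>2 * \<kappa>)"
proof -
  have "chirplet g \<sigma> x t \<eta> \<kappa> = \<sigma> *\<^sub>R (LINT s|lebesgue. x (t + \<sigma> * s) * of_real (1 / \<sigma> * g s)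
      * cis (- (2 * pi * \<eta> * (\<sigma> * s)) - pi * \<kappa> * (\<sigma> * s)\<^sup>2))"
    unfolding chirplet_def using assms
    by (subst lebesgue_integral_real_affine[of \<sigma> _ 0]) auto
  also have "\<dots> = wft (\<lambda>s. x (t + \<sigma> * s)) (\<sigma> * \<eta>) (\<sigma>\<^sup>2 * \<kappa>)"
    unfolding wft_def integral_scaleR_right[symmetric]
    using assms by (intro Bochner_Integration.integral_cong)
      (simp_all add: scaleR_conv_of_real power_mult_distrib mult_ac)
  finally show ?thesis .
qed

lemma ghat_0: "ghat 0 0 = 1"
  by (simp add: wft_def scaleR_conv_of_real integral)

lemma norm_ghat_le_1: "cmod (ghat \<eta> \<kappa>) \<le> 1"
  unfolding wft_def
  by (rule norm_integral_le_const) (auto intro!: continuous_intros simp: norm_mult)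

text \<open>The two kernels differ by at most the difference of their phases, which the support of
  \<open>g\<close> limits to \<open>\<bar>s\<bar> \<le> N\<close>.\<close>

lemma wft_lipschitz:
  assumes X: "continuous_on UNIV X" and B: "\<And>s. \<bar>s\<bar> \<le> N \<Longrightarrow> cmod (X s) \<le> B"
  shows "cmod (wft X \<eta> \<kappa> - wft X \<eta>' \<kappa>')
    \<le> B * (2 * pi * N * \<bar>\<eta> - \<eta>'\<bar> + pi * N\<^sup>2 * \<bar>\<kappa> - \<kappa>'\<bar>)"
proof -
  let ?\<theta> = "\<lambda>\<eta> \<kappa> s. - (2 * pi * \<eta> * s) - pi * \<kappa> * s\<^sup>2 :: real"
  have "wft X \<eta> \<kappa> - wft X \<eta>' \<kappa>'
      = (LINT s|lebesgue. g s *\<^sub>R (X s * (cis (?\<theta> \<eta> \<kappa> s) - cis (?\<theta> \<eta>' \<kappa>' s))))"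
    unfolding wft_def
    by (subst Bochner_Integration.integral_diff[symmetric])
       (auto intro!: integrable_wft[OF X] simp: scaleR_diff_right right_diff_distrib)
  also have "cmod \<dots> \<le> B * (2 * pi * N * \<bar>\<eta> - \<eta>'\<bar> + pi * N\<^sup>2 * \<bar>\<kappa> - \<kappa>'\<bar>)"
  proof (rule norm_integral_le_const)
    fix s :: real assume s: "\<bar>s\<bar> \<le> N"
    have s2: "s\<^sup>2 \<le> N\<^sup>2" using power_mono[OF s, of 2] by simp
    have "cmod (cis (?\<theta> \<eta> \<kappa> s) - cis (?\<theta> \<eta>' \<kappa>' s)) \<le> \<bar>?\<theta> \<eta> \<kappa> s - ?\<theta> \<eta>' \<kappa>' s\<bar>"
      by (rule norm_cis_diff_le)
    also have "?\<theta> \<eta> \<kappa> s - ?\<theta> \<eta>' \<kappa>' s = - (2 * pi * s * (\<eta> - \<eta>') + pi * s\<^sup>2 * (\<kappa> - \<kappa>'))"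
      by (simp add: algebra_simps)
    also have "\<bar>\<dots>\<bar> \<le> 2 * pi * \<bar>s\<bar> * \<bar>\<eta> - \<eta>'\<bar> + pi * s\<^sup>2 * \<bar>\<kappa> - \<kappa>'\<bar>"
      using abs_triangle_ineq[of "2 * pi * s * (\<eta> - \<eta>')" "pi * s\<^sup>2 * (\<kappa> - \<kappa>')"]
      by (simp add: abs_mult)
    also have "\<dots> \<le> 2 * pi * N * \<bar>\<eta> - \<eta>'\<bar> + pi * N\<^sup>2 * \<bar>\<kappa> - \<kappa>'\<bar>"
      using s s2 by (intro add_mono mult_right_mono mult_left_mono) auto
    finally have "cmod (cis (?\<theta> \<eta> \<kappa> s) - cis (?\<theta> \<eta>' \<kappa>' s))
        \<le> 2 * pi * N * \<bar>\<eta> - \<eta>'\<bar> + pi * N\<^sup>2 * \<bar>\<kappa> - \<kappa>'\<bar>" .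
    then show "cmod (X s * (cis (?\<theta> \<eta> \<kappa> s) - cis (?\<theta> \<eta>' \<kappa>' s)))
        \<le> B * (2 * pi * N * \<bar>\<eta> - \<eta>'\<bar> + pi * N\<^sup>2 * \<bar>\<kappa> - \<kappa>'\<bar>)"
      unfolding norm_mult
      using B[OF s] by (intro mult_mono) (auto intro: order_trans[OF norm_ge_zero])
  qed (auto intro!: continuous_intros X)
  finally show ?thesis .
qed

lemma continuous_on_wft:
  assumes X: "continuous_on UNIV X"
  shows "continuous_on UNIV (\<lambda>p. wft X (fst p) (snd p))"
proof -
  have "compact (X ` {-N..N})"
    by (intro compact_continuous_image continuous_on_subset[OF X]) auto
  then obtain B where "cmod (X s) \<le> B" if "s \<in> {-N..N}" for s
    using compact_imp_bounded bounded_iff by (metis imageI)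
  then have B: "cmod (X s) \<le> B" if "\<bar>s\<bar> \<le> N" for s using that by (simp add: abs_le_iff)
  show ?thesis unfolding continuous_on_def
  proof
    fix p :: "real \<times> real"
    have "((\<lambda>q. wft X (fst q) (snd q) - wft X (fst p) (snd p)) \<longlongrightarrow> 0) (at p)"
    proof (rule Lim_null_comparison)
      show "\<forall>\<^sub>F q in at p. norm (wft X (fst q) (snd q) - wft X (fst p) (snd p))
          \<le> B * (2 * pi * N * \<bar>fst q - fst p\<bar> + pi * N\<^sup>2 * \<bar>snd q - snd p\<bar>)"
        by (intro always_eventually allI wft_lipschitz X B)
      show "((\<lambda>q. B * (2 * pi * N * \<bar>fst q - fst p\<bar> + pi * N\<^sup>2 * \<bar>snd q - snd p\<bar>)) \<longlongrightarrow> 0) (at p)"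
        by (auto intro!: tendsto_eq_intros)
    qed
    then show "((\<lambda>p. wft X (fst p) (snd p)) \<longlongrightarrow> wft X (fst p) (snd p)) (at p within UNIV)"
      by (simp add: LIM_zero_iff)
  qed
qed

section \<open>Behaviour of \<open>ghat\<close> near its maximum at the origin\<close>

lemma norm_ghat_minus_1_le:
  "cmod (ghat \<eta> \<kappa> - 1) \<le> 2 * pi * N * \<bar>\<eta>\<bar> + pi * N\<^sup>2 * \<bar>\<kappa>\<bar>"
  using wft_lipschitz[of "\<lambda>_. 1" 1 \<eta> \<kappa> 0 0] by (simp add: ghat_0)

text \<open>Equality case of the triangle inequality. If \<open>u = ghat \<eta> \<kappa>\<close> had
  modulus 1, the integral of \<open>g s * (1 - Re (cnj u * cis (\<theta> s)))\<close> would be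
  \<open>1 - Re (cnj u * u) = 0\<close>. The second factor is nonnegative and vanishes only where
  \<open>cis (\<theta> s) = u\<close>, a countable set, so the integral is positive.\<close>

lemma norm_ghat_less_1:
  assumes "(\<eta>, \<kappa>) \<noteq> (0, 0)"
  shows "cmod (ghat \<eta> \<kappa>) < 1"
proof (rule ccontr)
  assume "\<not> ?thesis"
  with norm_ghat_le_1[of \<eta> \<kappa>] have u1: "cmod (ghat \<eta> \<kappa>) = 1" by simp
  define u where "u = ghat \<eta> \<kappa>"
  define \<theta> where "\<theta> s = - (2 * pi * \<eta> * s) - pi * \<kappa> * s\<^sup>2" for s
  have u: "cmod u = 1" using u1 by (simp add: u_def)
  have c\<theta>: "continuous_on UNIV \<theta>" unfolding \<theta>_def by (intro continuous_intros)
  have Z: "countable {s. \<bar>s\<bar> \<le> N \<and> 1 - Re (cnj u * cis (\<theta> s)) = 0}"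
  proof (rule countable_subset)
    show "countable {s. cis ((- 2 * pi * \<eta>) * s + (- pi * \<kappa>) * s\<^sup>2) = u}"
      by (rule countable_quadratic_phase_level_set) (use assms in auto)
    show "{s. \<bar>s\<bar> \<le> N \<and> 1 - Re (cnj u * cis (\<theta> s)) = 0} \<subseteq>
        {s. cis ((- 2 * pi * \<eta>) * s + (- pi * \<kappa>) * s\<^sup>2) = u}"
    proof clarify
      fix s assume "1 - Re (cnj u * cis (\<theta> s)) = 0"
      then have "Re (cnj u * cis (\<theta> s)) = 1" by simp
      then have 1: "Re u * cos (\<theta> s) + Im u * sin (\<theta> s) = 1" by simp
      have 2: "(Re u)\<^sup>2 + (Im u)\<^sup>2 = 1" using u by (simp add: cmod_def)
      \<comment> \<open>Two unit vectors with inner product 1 coincide: the squared distance is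
        \<open>1 + 1 - 2\<close>.\<close>
      have "(Re u - cos (\<theta> s))\<^sup>2 + (Im u - sin (\<theta> s))\<^sup>2
          = ((Re u)\<^sup>2 + (Im u)\<^sup>2) + ((cos (\<theta> s))\<^sup>2 + (sin (\<theta> s))\<^sup>2)
            - 2 * (Re u * cos (\<theta> s) + Im u * sin (\<theta> s))"
        by (simp add: power2_eq_square algebra_simps)
      also have "\<dots> = 0" unfolding 1 2 by simp
      finally have "cis (\<theta> s) = u" by (simp add: sum_power2_eq_zero_iff complex_eq_iff)
      then show "cis ((- 2 * pi * \<eta>) * s + (- pi * \<kappa>) * s\<^sup>2) = u"
        by (simp add: \<theta>_def)
    qed
  qed
  have "0 < (LINT s|lebesgue. g s * (1 - Re (cnj u * cis (\<theta> s))))"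
  proof (rule integral_pos[OF _ _ Z])
    show "continuous_on UNIV (\<lambda>s. 1 - Re (cnj u * cis (\<theta> s)))"
      by (intro continuous_intros c\<theta>)
    show "0 \<le> 1 - Re (cnj u * cis (\<theta> s))" for s
      using complex_Re_le_cmod[of "cnj u * cis (\<theta> s)"] u by (simp add: norm_mult)
  qed
  also have "\<dots> = 1 - (LINT s|lebesgue. Re (cnj u * (g s *\<^sub>R (1 * cis (\<theta> s)))))"
  proof -
    have i: "integrable lebesgue (\<lambda>s. g s *\<^sub>R (1 * cis (\<theta> s)))"
      unfolding \<theta>_def by (rule integrable_wft) simp
    then have "integrable lebesgue (\<lambda>s. Re (cnj u * (g s *\<^sub>R (1 * cis (\<theta> s)))))"
      by (intro integrable_Re integrable_mult_right)
    then have "(LINT s|lebesgue. g s - Re (cnj u * (g s *\<^sub>R (1 * cis (\<theta> s)))))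
        = 1 - (LINT s|lebesgue. Re (cnj u * (g s *\<^sub>R (1 * cis (\<theta> s)))))"
      by (subst Bochner_Integration.integral_diff) (auto simp: integrable integral)
    then show ?thesis by (simp add: algebra_simps)
  qed
  also have "(LINT s|lebesgue. Re (cnj u * (g s *\<^sub>R (1 * cis (\<theta> s))))) = Re (cnj u * u)"
  proof -
    have i: "integrable lebesgue (\<lambda>s. g s *\<^sub>R (1 * cis (\<theta> s)))"
      unfolding \<theta>_def by (rule integrable_wft) simp
    then have "(LINT s|lebesgue. Re (cnj u * (g s *\<^sub>R (1 * cis (\<theta> s)))))
        = Re (cnj u * (LINT s|lebesgue. g s *\<^sub>R (1 * cis (\<theta> s))))"
      by (subst integral_Re) (simp_all del: mult_1 mult_scaleR_right)
    then show ?thesis unfolding u_def wft_def \<theta>_def .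
  qed
  also have "cnj u * u = 1" using u complex_norm_square[of u] by (simp add: mult.commute)
  finally show False by simp
qed

text \<open>The decay condition solved for the argument; at the origin, which that condition
  excludes, the left side is 0.\<close>

lemma ghat_superlevel_le:
  assumes "c > 0" "c \<le> cmod (ghat \<eta> \<kappa>)"
  shows "\<bar>\<eta>\<bar> + \<bar>\<kappa>\<bar> \<le> (C / c)\<^sup>2"
proof (cases "(\<eta>, \<kappa>) = (0, 0)")
  case False
  then have pos: "\<bar>\<eta>\<bar> + \<bar>\<kappa>\<bar> > 0" by auto
  have "c \<le> C / sqrt (\<bar>\<eta>\<bar> + \<bar>\<kappa>\<bar>)" using decay[OF False] assms by (simp add: ghat_eq)
  then have "sqrt (\<bar>\<eta>\<bar> + \<bar>\<kappa>\<bar>) \<le> C / c" using pos \<open>c > 0\<close> by (simp add: field_simps)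
  then have "(sqrt (\<bar>\<eta>\<bar> + \<bar>\<kappa>\<bar>))\<^sup>2 \<le> (C / c)\<^sup>2" by (intro power_mono) auto
  then show ?thesis by simp
qed simp

text \<open>On the compact annulus of arguments of size between \<delta> and \<open>R\<close> the
  modulus of \<open>ghat\<close> attains a maximum, which is below 1; this gap bounds the deficit
  from below there.\<close>

lemma small_deficit_imp_small:
  assumes "\<delta> > 0"
  obtains \<epsilon> where "\<epsilon> > 0" "\<And>\<eta> \<kappa>. 1 - cmod (ghat \<eta> \<kappa>) \<le> \<epsilon> \<Longrightarrow> \<bar>\<eta>\<bar> + \<bar>\<kappa>\<bar> < \<delta>"
proof -
  \<comment> \<open>Decay at level 1/2: a deficit of at most 1/2 keeps the argument within
    \<open>R\<close>, hence the cap \<open>min \<epsilon> (1/2)\<close> at the end.\<close>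
  define R where "R = (C / (1/2))\<^sup>2"
  define S where "S = {p :: real \<times> real. \<delta> \<le> \<bar>fst p\<bar> + \<bar>snd p\<bar> \<and> \<bar>fst p\<bar> + \<bar>snd p\<bar> \<le> R}"
  have "compact S"
  proof -
    have "closed S" unfolding S_def Collect_conj_eq
      by (intro closed_Int closed_Collect_le continuous_intros)
    moreover have "bounded S"
    proof (rule bounded_subset)
      show "S \<subseteq> {-R..R} \<times> {-R..R}" by (auto simp: S_def)
    qed (simp add: bounded_Times)
    ultimately show ?thesis by (simp add: compact_eq_bounded_closed)
  qed
  have "\<exists>\<epsilon>>0. \<forall>p\<in>S. \<epsilon> < 1 - cmod (ghat (fst p) (snd p))"
  proof (cases "S = {}")
    case False
    have "continuous_on S (\<lambda>p. cmod (ghat (fst p) (snd p)))"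
      by (intro continuous_on_norm continuous_on_subset[OF continuous_on_wft]) auto
    from continuous_attains_sup[OF \<open>compact S\<close> False this]
    obtain p where p: "p \<in> S" "\<And>q. q \<in> S \<Longrightarrow> cmod (ghat (fst q) (snd q)) \<le> cmod (ghat (fst p) (snd p))"
      by auto
    have "cmod (ghat (fst p) (snd p)) < 1"
      by (rule norm_ghat_less_1) (use p(1) \<open>\<delta> > 0\<close> in \<open>auto simp: S_def\<close>)
    then show ?thesis using p(2)
      by (intro exI[of _ "(1 - cmod (ghat (fst p) (snd p))) / 2"]) fastforce
  qed (auto intro: exI[of _ 1])
  then obtain \<epsilon> where "\<epsilon> > 0" and \<epsilon>: "\<And>p. p \<in> S \<Longrightarrow> \<epsilon> < 1 - cmod (ghat (fst p) (snd p))"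
    by blast
  show ?thesis
  proof (rule that[of "min \<epsilon> (1/2)"])
    fix \<eta> \<kappa> assume *: "1 - cmod (ghat \<eta> \<kappa>) \<le> min \<epsilon> (1/2)"
    then have "\<bar>\<eta>\<bar> + \<bar>\<kappa>\<bar> \<le> R"
      unfolding R_def by (intro ghat_superlevel_le) auto
    moreover have "(\<eta>, \<kappa>) \<notin> S" using \<epsilon>[of "(\<eta>, \<kappa>)"] * by auto
    ultimately show "\<bar>\<eta>\<bar> + \<bar>\<kappa>\<bar> < \<delta>" by (auto simp: S_def)
  qed (use \<open>\<epsilon> > 0\<close> in auto)
qed

text \<open>Packs the preceding statement into one function \<open>h\<close> that depends only on
  the window and \<open>D\<close>. Being fixed before any signal is chosen, it makes the final
  \<open>o(1)\<close> terms uniform over signals.\<close>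

lemma deficit_modulus:
  obtains h where "(h \<longlongrightarrow> 0) (at_right (0::real))"
    "\<forall>\<^sub>F \<epsilon> in at_right 0. \<forall>\<eta> \<kappa>. 1 - cmod (ghat \<eta> \<kappa>) \<le> D * \<epsilon> \<longrightarrow> \<bar>\<eta>\<bar> + \<bar>\<kappa>\<bar> \<le> h \<epsilon>"
proof -
  \<comment> \<open>With \<open>\<bar>D\<bar>\<close> for \<open>D\<close> the origin belongs to
    \<open>Q \<epsilon>\<close> for every positive \<epsilon>, so the supremum
    \<open>h \<epsilon>\<close> is never taken over the empty set.\<close>
  define Q where "Q \<epsilon> = {(\<eta>, \<kappa>). 1 - cmod (ghat \<eta> \<kappa>) \<le> \<bar>D\<bar> * \<epsilon>}" for \<epsilon>
  define h where "h \<epsilon> = (SUP (\<eta>, \<kappa>)\<in>Q \<epsilon>. \<bar>\<eta>\<bar> + \<bar>\<kappa>\<bar>)" for \<epsilon>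
  have small: "\<forall>\<^sub>F \<epsilon> in at_right 0. \<epsilon> > 0 \<and> (\<forall>\<eta> \<kappa>. (\<eta>, \<kappa>) \<in> Q \<epsilon> \<longrightarrow> \<bar>\<eta>\<bar> + \<bar>\<kappa>\<bar> \<le> \<delta>)"
    if \<delta>: "\<delta> > 0" for \<delta>
  proof -
    obtain e where e: "e > 0" "\<And>\<eta> \<kappa>. 1 - cmod (ghat \<eta> \<kappa>) \<le> e \<Longrightarrow> \<bar>\<eta>\<bar> + \<bar>\<kappa>\<bar> < \<delta>"
      using small_deficit_imp_small[OF \<delta>] by blast
    have "((\<lambda>\<epsilon>. \<bar>D\<bar> * \<epsilon>) \<longlongrightarrow> 0) (at_right 0)" by (auto intro!: tendsto_eq_intros)
    then have "\<forall>\<^sub>F \<epsilon> in at_right 0. \<bar>D\<bar> * \<epsilon> < e" using e(1) by (rule order_tendstoD)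
    with eventually_at_right_less show ?thesis
      by eventually_elim (use e(2) in \<open>force simp: Q_def less_imp_le\<close>)
  qed
  show ?thesis
  proof (rule that[of h])
    show "(h \<longlongrightarrow> 0) (at_right 0)"
    proof (rule tendstoI)
      fix \<delta> :: real assume "\<delta> > 0"
      then have "\<forall>\<^sub>F \<epsilon> in at_right 0. \<epsilon> > 0 \<and> (\<forall>\<eta> \<kappa>. (\<eta>, \<kappa>) \<in> Q \<epsilon> \<longrightarrow> \<bar>\<eta>\<bar> + \<bar>\<kappa>\<bar> \<le> \<delta> / 2)"
        by (intro small) auto
      then show "\<forall>\<^sub>F \<epsilon> in at_right 0. dist (h \<epsilon>) 0 < \<delta>"
      proof eventually_elim
        case (elim \<epsilon>)
        then have 0: "(0, 0) \<in> Q \<epsilon>" by (simp add: Q_def ghat_0)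
        have "h \<epsilon> \<le> \<delta> / 2" unfolding h_def using 0 elim by (intro cSUP_least) auto
        moreover have "0 \<le> h \<epsilon>" unfolding h_def
          by (rule cSUP_upper2[OF _ 0]) (use elim in \<open>auto intro!: bdd_aboveI[of _ "\<delta> / 2"]\<close>)
        ultimately show ?case using \<open>\<delta> > 0\<close> by simp
      qed
    qed
    show "\<forall>\<^sub>F \<epsilon> in at_right 0. \<forall>\<eta> \<kappa>. 1 - cmod (ghat \<eta> \<kappa>) \<le> D * \<epsilon> \<longrightarrow> \<bar>\<eta>\<bar> + \<bar>\<kappa>\<bar> \<le> h \<epsilon>"
      \<comment> \<open>Any radius would do: \<open>Q \<epsilon>\<close> only has to be bounded for
        its supremum to be an upper bound.\<close>
      using small[OF zero_less_one]
    proof eventually_elim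
      case (elim \<epsilon>)
      show ?case
      proof clarify
        fix \<eta> \<kappa> assume "1 - cmod (ghat \<eta> \<kappa>) \<le> D * \<epsilon>"
        also have "D * \<epsilon> \<le> \<bar>D\<bar> * \<epsilon>" using elim by (intro mult_right_mono) auto
        finally have "(\<eta>, \<kappa>) \<in> Q \<epsilon>" by (simp add: Q_def)
        moreover have "bdd_above ((\<lambda>(\<eta>, \<kappa>). \<bar>\<eta>\<bar> + \<bar>\<kappa>\<bar>) ` Q \<epsilon>)"
          using elim by (auto intro!: bdd_aboveI[of _ 1])
        ultimately show "\<bar>\<eta>\<bar> + \<bar>\<kappa>\<bar> \<le> h \<epsilon>"
          unfolding h_def using cSUP_upper[of "(\<eta>, \<kappa>)" "Q \<epsilon>"] by fastforce
      qed
    qed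
  qed
qed

end

section \<open>The chirplet transform of a multicomponent signal\<close>

lemma C3_has_derivs:
  assumes "C3 f"
  shows "(f has_real_derivative deriv f s) (at s)"
    "(deriv f has_real_derivative deriv (deriv f) s) (at s)"
    "(deriv (deriv f) has_real_derivative deriv (deriv (deriv f)) s) (at s)"
  using assms unfolding C3_def
  by (auto simp: differentiable_on_def DERIV_deriv_iff_real_differentiable)

lemma C3_continuous_on: "C3 f \<Longrightarrow> continuous_on UNIV f"
  unfolding C3_def by (auto intro: differentiable_imp_continuous_on)

text \<open>Third-order Maclaurin expansion, with Lagrange remainder, of \<open>f\<close> shifted by
  \<open>t\<close>; the two-sided version admits \<tau> of either sign.\<close>

lemma C3_taylor:
  assumes f: "C3 f" and B: "\<And>s. \<bar>deriv (deriv (deriv f)) s\<bar> \<le> B"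
  shows "\<bar>f (t + \<tau>) - (f t + deriv f t * \<tau> + deriv (deriv f) t * \<tau>\<^sup>2 / 2)\<bar> \<le> B / 6 * \<bar>\<tau>\<bar> ^ 3"
proof -
  define d where "d m s = (deriv ^^ m) f (t + s)" for m s
  have "DERIV (d m) s :> d (Suc m) s" if "m < 3" for m s
  proof -
    from that have "m = 0 \<or> m = 1 \<or> m = 2" by auto
    then have "((deriv ^^ m) f has_real_derivative (deriv ^^ Suc m) f (t + s)) (at (t + s))"
      using C3_has_derivs[OF f, of "t + s"] by (auto simp: numeral_2_eq_2)
    then show ?thesis unfolding d_def by (simp add: DERIV_shift add.commute)
  qed
  then obtain s where "d 0 \<tau> = (\<Sum>m<3. d m 0 / fact m * \<tau> ^ m) + d 3 s / fact 3 * \<tau> ^ 3"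
    using Maclaurin_bi_le[of d "d 0" 3 \<tau>] by auto
  then have "f (t + \<tau>) - (f t + deriv f t * \<tau> + deriv (deriv f) t * \<tau>\<^sup>2 / 2)
      = deriv (deriv (deriv f)) (t + s) / 6 * \<tau> ^ 3"
    by (simp add: d_def numeral_3_eq_3 numeral_2_eq_2 fact_numeral lessThan_Suc)
  also have "\<bar>\<dots>\<bar> \<le> B / 6 * \<bar>\<tau>\<bar> ^ 3"
    using B[of "t + s"] by (simp add: abs_mult power_abs mult_right_mono)
  finally show ?thesis .
qed

text \<open>One signal at one time \<open>t\<close> below the threshold. The assumption
  \<open>\<sigma>_ge\<close> lets the separation condition, which weighs chirp rates by \<rho>, be
  rescaled to the weight \<open>\<rho> * \<sigma>\<^sup>2\<close> of the sets
  \<open>G_comp\<close>.\<close>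

locale chirplet_analysis = window +
  fixes B1 B2 \<rho> \<Delta> c0 L \<alpha> \<sigma> :: real and x :: "real \<Rightarrow> complex"
    and K :: nat and A \<phi> :: "nat \<Rightarrow> real \<Rightarrow> real" and t :: real
  assumes B1: "B1 > 0" and B2: "B2 > 0" and \<rho>: "\<rho> \<ge> 0" and \<Delta>: "\<Delta> > 0" and c0: "c0 > 0"
    and L: "L = window_L \<rho> C"
    and \<alpha>: "\<alpha> > 0" and \<sigma>_eq: "\<sigma> = c0 / \<alpha>\<^sup>2" and \<sigma>_ge: "\<rho> > 0 \<Longrightarrow> \<sigma> \<ge> 1"
    and x: "class_A \<alpha> B1 B2 \<rho> \<Delta> x K A \<phi>"
    and \<alpha>_le: "\<alpha> \<le> alpha_max c0 N B1 B2 \<Delta> L (amp_min K A t) (amp_sum K A t)"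
begin

abbreviation "\<mu> \<equiv> amp_min K A t"
abbreviation "M \<equiv> amp_sum K A t"
abbreviation "S \<equiv> chirplet g \<sigma> x t"
abbreviation "\<phi>1 k \<equiv> deriv (\<phi> k) t"
abbreviation "\<phi>2 k \<equiv> deriv (deriv (\<phi> k)) t"

text \<open>The factor that multiplies the \<open>k\<close>-th component in the model of
  \<open>S\<close>; it equals 1 on the \<open>k\<close>-th ridge.\<close>

definition H :: "nat \<Rightarrow> real \<Rightarrow> real \<Rightarrow> complex" where
  "H k \<eta> \<kappa> = ghat (\<sigma> * (\<eta> - \<phi>1 k)) (\<sigma>\<^sup>2 * (\<kappa> - \<phi>2 k))"

definition offset :: "nat \<Rightarrow> real \<Rightarrow> real \<Rightarrow> real" where
  "offset k \<eta> \<kappa> = \<sigma> * \<bar>\<eta> - \<phi>1 k\<bar> + \<rho> * \<sigma>\<^sup>2 * \<bar>\<kappa> - \<phi>2 k\<bar>"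

definition model_err :: real where
  "model_err = \<alpha> * M * (c0 * N * B1 + pi / 3 * B2 * c0 ^ 3 * N ^ 3)"

text \<open>Bound for \<open>H k\<close> at points of offset at least
  \<open>\<sigma> * \<Delta>\<close> from ridge \<open>k\<close>, namely
  \<open>L / sqrt (\<sigma> * \<Delta>)\<close> expressed through \<alpha>.\<close>

definition cross_err :: real where
  "cross_err = \<alpha> * L / sqrt (c0 * \<Delta>)"

section \<open>Amplitudes and continuity of the signal\<close>

lemma \<sigma>_pos: "\<sigma> > 0"
  using c0 \<alpha> by (simp add: \<sigma>_eq)

lemma A_pos: "k \<le> K \<Longrightarrow> A k s > 0"
  and \<phi>_C3: "k \<le> K \<Longrightarrow> C3 (\<phi> k)"
  and A_lip: "k \<le> K \<Longrightarrow> \<bar>A k (s + \<tau>) - A k s\<bar> \<le> \<alpha> ^ 3 * B1 * \<bar>\<tau>\<bar> * A k s"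
  and \<phi>3_le: "k \<le> K \<Longrightarrow> \<bar>deriv (deriv (deriv (\<phi> k))) s\<bar> \<le> \<alpha> ^ 7 * B2"
  and separation: "k \<le> K \<Longrightarrow> l \<le> K \<Longrightarrow> k \<noteq> l \<Longrightarrow> \<bar>\<phi>1 k - \<phi>1 l\<bar> + \<rho> * \<bar>\<phi>2 k - \<phi>2 l\<bar> \<ge> 2 * \<Delta>"
  and x_eq: "x s = (\<Sum>k\<le>K. component A \<phi> k s)"
  using x unfolding class_A_def by auto

lemma norm_component: "k \<le> K \<Longrightarrow> cmod (component A \<phi> k t) = A k t"
  using A_pos[of k t] by (simp add: component_def norm_mult)

lemma M_eq: "M = (\<Sum>k\<le>K. A k t)"
  unfolding amp_sum_def by (intro sum.cong) (use A_pos in \<open>auto simp: less_imp_le\<close>)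

lemma A_le_M: "k \<le> K \<Longrightarrow> A k t \<le> M"
  unfolding M_eq by (intro member_le_sum) (use A_pos in \<open>auto simp: less_imp_le\<close>)

lemma M_pos: "M > 0"
  using A_le_M[of 0] A_pos[of 0 t] by simp

lemma \<mu>_le_A: "k \<le> K \<Longrightarrow> \<mu> \<le> A k t"
  unfolding amp_min_def using A_pos[of k t] by (intro Min.coboundedI) (auto intro!: image_eqI[of _ _ k])

lemma \<mu>_pos: "\<mu> > 0"
  unfolding amp_min_def by (subst Min_gr_iff) (use A_pos[of _ t] in force)+

text \<open>Continuity comes from the Lipschitz condition relative to \<open>A k s\<close>;
  membership in \<open>L_infinity\<close> would not give it.\<close>

lemma continuous_on_A:
  assumes "k \<le> K"
  shows "continuous_on UNIV (A k)"
  unfolding continuous_on_def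
proof
  fix s
  have "((\<lambda>r. A k r - A k s) \<longlongrightarrow> 0) (at s)"
  proof (rule Lim_null_comparison)
    show "\<forall>\<^sub>F r in at s. norm (A k r - A k s) \<le> \<alpha> ^ 3 * B1 * \<bar>r - s\<bar> * A k s"
      using A_lip[OF assms, of s "r - s" for r] by (intro always_eventually) simp
    show "((\<lambda>r. \<alpha> ^ 3 * B1 * \<bar>r - s\<bar> * A k s) \<longlongrightarrow> 0) (at s)"
      by (auto intro!: tendsto_eq_intros)
  qed
  then show "(A k \<longlongrightarrow> A k s) (at s within UNIV)" by (simp add: LIM_zero_iff)
qed

lemma continuous_on_component: "k \<le> K \<Longrightarrow> continuous_on UNIV (component A \<phi> k)"
  unfolding component_def
  by (intro continuous_intros continuous_on_A C3_continuous_on[OF \<phi>_C3])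

lemma continuous_on_component_affine:
  "k \<le> K \<Longrightarrow> continuous_on UNIV (\<lambda>s. component A \<phi> k (t + \<sigma> * s))"
  by (rule continuous_on_compose2[OF continuous_on_component]) (auto intro!: continuous_intros)

lemma continuous_on_x_affine: "continuous_on UNIV (\<lambda>s. x (t + \<sigma> * s))"
  unfolding x_eq by (intro continuous_on_sum continuous_on_component_affine) auto

section \<open>Approximation of the chirplet transform by the model\<close>

lemma component_taylor:
  assumes k: "k \<le> K"
  shows "cmod (component A \<phi> k (t + \<tau>) - component A \<phi> k t * cis (2 * pi * (\<phi>1 k * \<tau> + \<phi>2 k * \<tau>\<^sup>2 / 2)))
    \<le> A k t * (\<alpha> ^ 3 * B1 * \<bar>\<tau>\<bar> + pi / 3 * (\<alpha> ^ 7 * B2) * \<bar>\<tau>\<bar> ^ 3)"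
proof -
  let ?p = "\<phi> k (t + \<tau>)" and ?q = "\<phi> k t + \<phi>1 k * \<tau> + \<phi>2 k * \<tau>\<^sup>2 / 2"
  have "component A \<phi> k (t + \<tau>) - component A \<phi> k t * cis (2 * pi * (\<phi>1 k * \<tau> + \<phi>2 k * \<tau>\<^sup>2 / 2))
      = of_real (A k (t + \<tau>) - A k t) * cis (2 * pi * ?p)
        + of_real (A k t) * (cis (2 * pi * ?p) - cis (2 * pi * ?q))"
    by (simp add: component_def cis_mult algebra_simps)
  also have "cmod \<dots> \<le> \<bar>A k (t + \<tau>) - A k t\<bar> + A k t * cmod (cis (2 * pi * ?p) - cis (2 * pi * ?q))"
    by (rule order_trans[OF norm_triangle_ineq])
       (use A_pos[OF k, of t] in \<open>simp add: norm_mult flip: of_real_diff\<close>)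
  also have "\<dots> \<le> \<alpha> ^ 3 * B1 * \<bar>\<tau>\<bar> * A k t + A k t * (pi / 3 * (\<alpha> ^ 7 * B2) * \<bar>\<tau>\<bar> ^ 3)"
  proof (intro add_mono mult_left_mono)
    have "cmod (cis (2 * pi * ?p) - cis (2 * pi * ?q)) \<le> \<bar>2 * pi * ?p - 2 * pi * ?q\<bar>"
      by (rule norm_cis_diff_le)
    also have "\<dots> = 2 * pi * \<bar>?p - ?q\<bar>"
      by (simp add: abs_mult flip: right_diff_distrib)
    also have "\<dots> \<le> 2 * pi * (\<alpha> ^ 7 * B2 / 6 * \<bar>\<tau>\<bar> ^ 3)"
      by (intro mult_left_mono C3_taylor \<phi>_C3 k \<phi>3_le) auto
    finally show "cmod (cis (2 * pi * ?p) - cis (2 * pi * ?q)) \<le> pi / 3 * (\<alpha> ^ 7 * B2) * \<bar>\<tau>\<bar> ^ 3"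
      by (simp add: mult_ac)
  qed (use A_lip[OF k] A_pos[OF k, of t] in auto)
  finally show ?thesis by (simp add: algebra_simps)
qed

text \<open>Recentring the arguments of \<open>ghat\<close> at the ridge amounts to multiplying the
  integrand by the quadratic Taylor chirp, so each model term is the transform of a component with
  frozen amplitude and quadratic phase.\<close>

lemma component_mult_H:
  "component A \<phi> k t * H k \<eta> \<kappa> =
    (LINT s|lebesgue. g s *\<^sub>R (component A \<phi> k t
      * cis (2 * pi * (\<phi>1 k * (\<sigma> * s) + \<phi>2 k * (\<sigma> * s)\<^sup>2 / 2))
      * cis (- (2 * pi * (\<sigma> * \<eta>) * s) - pi * (\<sigma>\<^sup>2 * \<kappa>) * s\<^sup>2)))"
proof -
  have "- (2 * pi * (\<sigma> * (\<eta> - \<phi>1 k)) * s) - pi * (\<sigma>\<^sup>2 * (\<kappa> - \<phi>2 k)) * s\<^sup>2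
      = 2 * pi * (\<phi>1 k * (\<sigma> * s) + \<phi>2 k * (\<sigma> * s)\<^sup>2 / 2)
        + (- (2 * pi * (\<sigma> * \<eta>) * s) - pi * (\<sigma>\<^sup>2 * \<kappa>) * s\<^sup>2)" for s
    by (simp add: algebra_simps power_mult_distrib)
  then show ?thesis
    unfolding H_def wft_def integral_mult_right_zero[symmetric]
    by (simp add: mult.assoc flip: cis_mult)
qed

text \<open>The strict inequality, due to \<open>g\<close> having no atoms at \<open>N\<close> and \<open>-N\<close>, is what separates
  the components of the superlevel set when \<open>\<alpha>\<close> equals the threshold.\<close>

lemma S_minus_model_less:
  "cmod (S \<eta> \<kappa> - (\<Sum>k\<le>K. component A \<phi> k t * H k \<eta> \<kappa>)) < model_err"
proof -
  define e where "e s = cis (- (2 * pi * (\<sigma> * \<eta>) * s) - pi * (\<sigma>\<^sup>2 * \<kappa>) * s\<^sup>2)" for s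
  define y where "y k s = component A \<phi> k t * cis (2 * pi * (\<phi>1 k * (\<sigma> * s) + \<phi>2 k * (\<sigma> * s)\<^sup>2 / 2))" for k s
  define f where "f s = (\<Sum>k\<le>K. (component A \<phi> k (t + \<sigma> * s) - y k s) * e s)" for s
  \<comment> \<open>Sum over \<open>k\<close> of the bounds in \<open>component_taylor\<close> at
    \<tau> = \<sigma> s; on \<open>{-N..N}\<close> it is largest exactly at the two end
    points.\<close>
  define h where "h s = M * (\<alpha> ^ 3 * B1 * (\<sigma> * \<bar>s\<bar>) + pi / 3 * (\<alpha> ^ 7 * B2) * (\<sigma> * \<bar>s\<bar>) ^ 3)" for s
  have ce: "continuous_on UNIV e" unfolding e_def by (intro continuous_intros)
  have cy: "continuous_on UNIV (y k)" for k unfolding y_def by (intro continuous_intros) auto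
  have cf: "continuous_on UNIV f"
    unfolding f_def by (intro continuous_intros ce cy continuous_on_component_affine) auto
  have ch: "continuous_on UNIV h" unfolding h_def by (intro continuous_intros)
  have "S \<eta> \<kappa> - (\<Sum>k\<le>K. component A \<phi> k t * H k \<eta> \<kappa>)
      = (LINT s|lebesgue. g s *\<^sub>R (x (t + \<sigma> * s) * e s)) - (\<Sum>k\<le>K. LINT s|lebesgue. g s *\<^sub>R (y k s * e s))"
    unfolding chirplet_eq_wft[OF \<sigma>_pos] wft_def component_mult_H e_def y_def by (rule refl)
  also have "\<dots> = (LINT s|lebesgue. g s *\<^sub>R (x (t + \<sigma> * s) * e s) - (\<Sum>k\<le>K. g s *\<^sub>R (y k s * e s)))"
  proof -
    have "integrable lebesgue (\<lambda>s. g s *\<^sub>R (x (t + \<sigma> * s) * e s))"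
      by (intro integrable_scaleR continuous_on_mult continuous_on_x_affine ce)
    moreover have y: "integrable lebesgue (\<lambda>s. g s *\<^sub>R (y k s * e s))" for k
      by (intro integrable_scaleR continuous_on_mult cy ce)
    ultimately show ?thesis
      by (simp only: Bochner_Integration.integral_diff Bochner_Integration.integral_sum
          Bochner_Integration.integrable_sum)
  qed
  also have "\<dots> = (LINT s|lebesgue. g s *\<^sub>R f s)"
    unfolding f_def x_eq left_diff_distrib sum_subtractf scaleR_diff_right
      scaleR_sum_right[symmetric] sum_distrib_right[symmetric] by (rule refl)
  also have "cmod \<dots> \<le> (LINT s|lebesgue. g s * h s)"
  proof (rule norm_integral_le[OF cf ch])
    fix s
    have "cmod (f s) \<le> (\<Sum>k\<le>K. cmod (component A \<phi> k (t + \<sigma> * s) - y k s))"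
      unfolding f_def by (rule order_trans[OF norm_sum]) (simp add: norm_mult e_def)
    also have "\<dots> \<le> (\<Sum>k\<le>K. A k t * (\<alpha> ^ 3 * B1 * \<bar>\<sigma> * s\<bar> + pi / 3 * (\<alpha> ^ 7 * B2) * \<bar>\<sigma> * s\<bar> ^ 3))"
      unfolding y_def by (intro sum_mono component_taylor) auto
    also have "\<dots> = h s"
      using \<sigma>_pos by (simp add: h_def M_eq sum_distrib_right abs_mult)
    finally show "cmod (f s) \<le> h s" .
  qed
  also have "\<dots> < h N"
  proof -
    have less: "h s < h N" if "\<bar>s\<bar> < N" for s
      unfolding h_def using that M_pos \<alpha> B1 B2 \<sigma>_pos N_pos
      by (intro mult_strict_left_mono add_strict_mono power_strict_mono) auto
    have eq: "h s = h N" if "\<bar>s\<bar> = N" for s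
      using that N_pos by (simp add: h_def)
    have "0 < (LINT s|lebesgue. g s * (h N - h s))"
    proof (rule integral_pos)
      show "continuous_on UNIV (\<lambda>s. h N - h s)" by (intro continuous_intros ch)
      show "0 \<le> h N - h s" if "\<bar>s\<bar> \<le> N" for s
        using less[of s] eq[of s] that by (cases "\<bar>s\<bar> = N") auto
      show "countable {s. \<bar>s\<bar> \<le> N \<and> h N - h s = 0}"
      proof (rule countable_subset)
        show "{s. \<bar>s\<bar> \<le> N \<and> h N - h s = 0} \<subseteq> {N, - N}"
        proof
          fix s assume "s \<in> {s. \<bar>s\<bar> \<le> N \<and> h N - h s = 0}"
          then have "\<bar>s\<bar> = N" using less[of s] by force
          then show "s \<in> {N, - N}" by (auto simp: abs_if split: if_splits)
        qed
      qed simp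
    qed
    also have "\<dots> = h N - (LINT s|lebesgue. g s * h s)"
      unfolding right_diff_distrib
      by (subst Bochner_Integration.integral_diff) (auto intro!: integrable_mult ch simp: integrable integral)
    finally show ?thesis by simp
  qed
  \<comment> \<open>The powers \<alpha>^3 and \<alpha>^7 of the class are matched to
    \<open>\<sigma> = c0 / \<alpha>\<^sup>2\<close> so that both error terms become linear in
    \<alpha>.\<close>
  also have "h N = model_err"
  proof -
    have "\<alpha> ^ 3 * \<sigma> = \<alpha> * c0" "\<alpha> ^ 7 * \<sigma> ^ 3 = \<alpha> * c0 ^ 3"
      using \<alpha> by (simp_all add: \<sigma>_eq eval_nat_numeral)
    moreover have "h N = M * (B1 * N * (\<alpha> ^ 3 * \<sigma>) + pi / 3 * B2 * N ^ 3 * (\<alpha> ^ 7 * \<sigma> ^ 3))"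
      using N_pos by (simp add: h_def power_mult_distrib mult_ac)
    ultimately show ?thesis by (simp add: model_err_def algebra_simps)
  qed
  finally show ?thesis .
qed

section \<open>Consequences of the threshold on \<alpha>\<close>

lemma \<alpha>_le_first: "\<alpha> \<le> \<mu> / (4 * M * c0 * N * (B1 + pi / 3 * B2 * c0\<^sup>2 * N\<^sup>2))"
  and \<alpha>_le_second: "\<alpha> \<le> \<mu> * sqrt (c0 * \<Delta>) / (4 * M * L)"
  using \<alpha>_le by (simp_all add: alpha_max_def)

text \<open>For \<open>L \<le> 0\<close> the second bound on \<alpha> would be at most 0 (for
  \<open>L = 0\<close> because division by zero gives 0), against \<alpha> > 0.\<close>

lemma L_pos: "L > 0"
proof (rule ccontr)
  assume "\<not> L > 0"
  then have "\<mu> * sqrt (c0 * \<Delta>) / (4 * M * L) \<le> 0"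
    using \<mu>_pos M_pos c0 \<Delta> by (intro divide_nonneg_nonpos mult_nonneg_nonpos) auto
  then show False using \<alpha>_le_second \<alpha> by linarith
qed

lemma cross_err_pos: "cross_err > 0"
  using \<alpha> L_pos c0 \<Delta> by (simp add: cross_err_def)

lemma model_err_le: "model_err \<le> \<mu> / 4"
proof -
  define d where "d = M * c0 * N * (B1 + pi / 3 * B2 * c0\<^sup>2 * N\<^sup>2)"
  have "d > 0" unfolding d_def using M_pos c0 N_pos B1 B2
    by (intro mult_pos_pos add_pos_pos) auto
  have "4 * M * c0 * N * (B1 + pi / 3 * B2 * c0\<^sup>2 * N\<^sup>2) = 4 * d"
    by (simp add: d_def)
  then have "\<alpha> \<le> \<mu> / (4 * d)" using \<alpha>_le_first by (simp only:)
  then have "\<alpha> * d \<le> \<mu> / 4" using \<open>d > 0\<close> by (simp add: field_simps)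
  also have "\<alpha> * d = model_err"
    by (simp add: d_def model_err_def algebra_simps power2_eq_square power3_eq_cube)
  finally show ?thesis .
qed

lemma M_cross_err_le: "M * cross_err \<le> \<mu> / 4"
  using \<alpha>_le_second M_pos L_pos c0 \<Delta> by (simp add: cross_err_def field_simps)

lemma err_bound_eq: "err_bound c0 N B1 B2 \<Delta> L \<alpha> M = M * cross_err + model_err"
  by (simp add: err_bound_def cross_err_def model_err_def algebra_simps)

text \<open>Each of the two bounds on \<alpha> caps one of the two errors at
  \<open>\<mu> / 4\<close>.\<close>

lemma err_bound_le: "err_bound c0 N B1 B2 \<Delta> L \<alpha> M \<le> \<mu> / 2"
  using model_err_le M_cross_err_le by (simp add: err_bound_eq)

lemma cross_err_eq: "cross_err = L / sqrt (\<sigma> * \<Delta>)"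
  using \<alpha> by (simp add: cross_err_def \<sigma>_eq real_sqrt_mult real_sqrt_divide)

text \<open>The second bound on \<alpha> in geometric form: the radius of each \<open>G_comp\<close>
  is at most half the distance \<open>2 * (\<sigma> * \<Delta>)\<close> that the ridges keep from
  each other.\<close>

lemma radius_le: "(4 * L * M / \<mu>)\<^sup>2 \<le> \<sigma> * \<Delta>"
proof -
  have "4 * L * M / \<mu> \<le> sqrt (\<sigma> * \<Delta>)"
    using M_cross_err_le \<mu>_pos \<sigma>_pos \<Delta> by (simp add: cross_err_eq field_simps)
  then have "(4 * L * M / \<mu>)\<^sup>2 \<le> (sqrt (\<sigma> * \<Delta>))\<^sup>2"
    using L_pos M_pos \<mu>_pos by (intro power_mono) auto
  then show ?thesis using \<sigma>_pos \<Delta> by simp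
qed

section \<open>Decay and separation around the ridges\<close>

text \<open>The decay of \<open>ghat\<close> in the weighted norm: the weight \<rho> is absorbed by
  \<open>L\<^sup>2 = max 1 \<rho> * C\<^sup>2\<close>.\<close>

lemma H_superlevel_offset_le:
  assumes "c > 0" "c \<le> cmod (H k \<eta> \<kappa>)"
  shows "offset k \<eta> \<kappa> \<le> (L / c)\<^sup>2"
proof -
  let ?a = "\<bar>\<sigma> * (\<eta> - \<phi>1 k)\<bar>" and ?b = "\<bar>\<sigma>\<^sup>2 * (\<kappa> - \<phi>2 k)\<bar>"
  have L2: "L\<^sup>2 = max 1 \<rho> * C\<^sup>2"
    using \<rho> by (auto simp: L window_L_def power_mult_distrib max_def)
  have "offset k \<eta> \<kappa> = ?a + \<rho> * ?b"
    using \<sigma>_pos by (simp add: offset_def abs_mult)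
  also have "\<dots> \<le> max 1 \<rho> * ?a + max 1 \<rho> * ?b"
    using mult_right_mono[of 1 "max 1 \<rho>" ?a] by (intro add_mono mult_right_mono) auto
  also have "\<dots> \<le> max 1 \<rho> * (C / c)\<^sup>2"
    unfolding distrib_left[symmetric]
    by (intro mult_left_mono ghat_superlevel_le) (use assms in \<open>auto simp: H_def\<close>)
  also have "\<dots> = (L / c)\<^sup>2" by (simp add: power_divide L2)
  finally show ?thesis .
qed

text \<open>The superlevel bound is applied at the level \<open>cmod (H k \<eta> \<kappa>)\<close>
  itself, which is why the value 0 is treated apart.\<close>

lemma norm_H_le:
  assumes "offset k \<eta> \<kappa> \<ge> \<sigma> * \<Delta>"
  shows "cmod (H k \<eta> \<kappa>) \<le> cross_err"
proof (cases "H k \<eta> \<kappa> = 0")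
  case False
  then have c: "cmod (H k \<eta> \<kappa>) > 0" by simp
  have "\<sigma> * \<Delta> \<le> (L / cmod (H k \<eta> \<kappa>))\<^sup>2"
    using assms H_superlevel_offset_le[OF c order_refl] by linarith
  then have "sqrt (\<sigma> * \<Delta>) \<le> L / cmod (H k \<eta> \<kappa>)"
    using L_pos by (intro real_le_lsqrt) auto
  then show ?thesis
    unfolding cross_err_eq using c \<sigma>_pos \<Delta> by (simp add: field_simps)
qed (use cross_err_pos in simp)

text \<open>The separation condition times \<sigma>, followed by the triangle inequality through the
  point. Raising \<open>\<rho> * \<sigma>\<close> to \<open>\<rho> * \<sigma>\<^sup>2\<close> uses
  \<sigma> \<ge> 1, unless \<rho> = 0.\<close>

lemma offset_separated:
  assumes "k \<le> K" "l \<le> K" "k \<noteq> l"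
  shows "offset k \<eta> \<kappa> + offset l \<eta> \<kappa> \<ge> 2 * (\<sigma> * \<Delta>)"
proof -
  let ?a = "\<bar>\<phi>1 k - \<phi>1 l\<bar>" and ?b = "\<bar>\<phi>2 k - \<phi>2 l\<bar>"
  have "\<rho> * \<sigma> \<le> \<rho> * \<sigma>\<^sup>2"
  proof (cases "\<rho> = 0")
    case False
    then have "\<sigma> \<ge> 1" using \<rho> \<sigma>_ge by simp
    then show ?thesis using \<rho> by (intro mult_left_mono) (auto simp: power2_eq_square)
  qed simp
  then have b: "\<rho> * \<sigma> * ?b \<le> \<rho> * \<sigma>\<^sup>2 * ?b" by (rule mult_right_mono) simp
  have "2 * (\<sigma> * \<Delta>) = \<sigma> * (2 * \<Delta>)" by simp
  also have "\<dots> \<le> \<sigma> * (?a + \<rho> * ?b)"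
    using separation[OF assms] \<sigma>_pos by (intro mult_left_mono) auto
  also have "\<dots> = \<sigma> * ?a + \<rho> * \<sigma> * ?b" by (simp add: algebra_simps)
  also have "\<dots> \<le> \<sigma> * ?a + \<rho> * \<sigma>\<^sup>2 * ?b" using b by simp
  also have "\<dots> \<le> \<sigma> * (\<bar>\<eta> - \<phi>1 k\<bar> + \<bar>\<eta> - \<phi>1 l\<bar>) + \<rho> * \<sigma>\<^sup>2 * (\<bar>\<kappa> - \<phi>2 k\<bar> + \<bar>\<kappa> - \<phi>2 l\<bar>)"
    using \<sigma>_pos \<rho> by (intro add_mono mult_left_mono) auto
  also have "\<dots> = offset k \<eta> \<kappa> + offset l \<eta> \<kappa>" by (simp add: offset_def algebra_simps)
  finally show ?thesis .
qed

text \<open>Within \<open>\<sigma> * \<Delta>\<close> of ridge \<open>l\<close> every other ridge is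
  at least \<open>\<sigma> * \<Delta>\<close> away, so the other model terms add up to at most
  \<open>M * cross_err\<close>; the rest is \<open>model_err\<close>.\<close>

lemma S_minus_component_less:
  assumes l: "l \<le> K" and off: "offset l \<eta> \<kappa> \<le> \<sigma> * \<Delta>"
  shows "cmod (S \<eta> \<kappa> - component A \<phi> l t * H l \<eta> \<kappa>) < err_bound c0 N B1 B2 \<Delta> L \<alpha> M"
proof -
  let ?f = "\<lambda>k. component A \<phi> k t * H k \<eta> \<kappa>"
  have "cmod (\<Sum>k\<in>{..K} - {l}. ?f k) \<le> (\<Sum>k\<in>{..K} - {l}. A k t * cross_err)"
  proof (rule sum_norm_le)
    fix k assume k: "k \<in> {..K} - {l}"
    then have "cmod (H k \<eta> \<kappa>) \<le> cross_err"
      using offset_separated[of k l \<eta> \<kappa>] l off by (intro norm_H_le) auto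
    then show "cmod (?f k) \<le> A k t * cross_err"
      using k A_pos[of k t] by (auto simp: norm_mult norm_component intro: mult_left_mono)
  qed
  also have "\<dots> \<le> (\<Sum>k\<le>K. A k t * cross_err)"
    using A_pos cross_err_pos by (intro sum_mono2) (auto simp: less_imp_le)
  also have "\<dots> = M * cross_err" by (simp add: M_eq sum_distrib_right)
  finally have "cmod (\<Sum>k\<in>{..K} - {l}. ?f k) \<le> M * cross_err" .
  moreover have "(\<Sum>k\<le>K. ?f k) = ?f l + (\<Sum>k\<in>{..K} - {l}. ?f k)"
    using l by (intro sum.remove) auto
  then have "S \<eta> \<kappa> - ?f l = (S \<eta> \<kappa> - (\<Sum>k\<le>K. ?f k)) + (\<Sum>k\<in>{..K} - {l}. ?f k)" by simp
  then have "cmod (S \<eta> \<kappa> - ?f l)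
      \<le> cmod (S \<eta> \<kappa> - (\<Sum>k\<le>K. ?f k)) + cmod (\<Sum>k\<in>{..K} - {l}. ?f k)"
    by (simp only: norm_triangle_ineq)
  ultimately show ?thesis
    using S_minus_model_less[of \<eta> \<kappa>] unfolding err_bound_eq by linarith
qed

section \<open>Decomposition of the superlevel set\<close>

lemma G_comp_iff:
  "(\<eta>, \<kappa>) \<in> G_comp g \<sigma> \<rho> L x K A \<phi> t l \<longleftrightarrow>
    \<mu> / 2 \<le> cmod (S \<eta> \<kappa>) \<and> offset l \<eta> \<kappa> \<le> (4 * L * M / \<mu>)\<^sup>2"
  by (simp add: G_comp_def G_set_def offset_def)

lemma G_comp_imp_offset_le:
  "(\<eta>, \<kappa>) \<in> G_comp g \<sigma> \<rho> L x K A \<phi> t l \<Longrightarrow> offset l \<eta> \<kappa> \<le> \<sigma> * \<Delta>"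
  using radius_le by (simp add: G_comp_iff)

text \<open>If all factors were at most \<open>\<mu> / (4 * M)\<close>, the model would be at most
  \<open>\<mu> / 4\<close> and its error strictly less than \<open>\<mu> / 4\<close>. The strict
  conclusion inherits the strictness of that error.\<close>

lemma G_set_imp_H_ge:
  assumes "\<mu> / 2 \<le> cmod (S \<eta> \<kappa>)"
  obtains l where "l \<le> K" "\<mu> / (4 * M) < cmod (H l \<eta> \<kappa>)"
proof (rule ccontr)
  assume "\<not> thesis"
  with that have le: "cmod (H k \<eta> \<kappa>) \<le> \<mu> / (4 * M)" if "k \<le> K" for k
    using \<open>k \<le> K\<close> by force
  have "cmod (\<Sum>k\<le>K. component A \<phi> k t * H k \<eta> \<kappa>) \<le> (\<Sum>k\<le>K. A k t * (\<mu> / (4 * M)))"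
  proof (rule sum_norm_le)
    fix k assume "k \<in> {..K}"
    then show "cmod (component A \<phi> k t * H k \<eta> \<kappa>) \<le> A k t * (\<mu> / (4 * M))"
      unfolding norm_mult using A_pos[of k t] le[of k]
      by (intro mult_mono) (auto simp: norm_component)
  qed
  also have "\<dots> = \<mu> / 4"
    unfolding sum_distrib_right[symmetric] M_eq[symmetric] using M_pos by simp
  finally show False
    using assms S_minus_model_less[of \<eta> \<kappa>] model_err_le
      norm_triangle_sub[of "S \<eta> \<kappa>" "\<Sum>k\<le>K. component A \<phi> k t * H k \<eta> \<kappa>"]
    by linarith
qed

lemma G_set_eq_Union: "G_set g \<sigma> x K A t = (\<Union>l\<le>K. G_comp g \<sigma> \<rho> L x K A \<phi> t l)"
proof
  show "G_set g \<sigma> x K A t \<subseteq> (\<Union>l\<le>K. G_comp g \<sigma> \<rho> L x K A \<phi> t l)"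
  proof clarify
    fix \<eta> \<kappa> assume "(\<eta>, \<kappa>) \<in> G_set g \<sigma> x K A t"
    then have S: "\<mu> / 2 \<le> cmod (S \<eta> \<kappa>)" by (simp add: G_set_def)
    then obtain l where l: "l \<le> K" "\<mu> / (4 * M) < cmod (H l \<eta> \<kappa>)" by (rule G_set_imp_H_ge)
    \<comment> \<open>This level is the origin of the radius
      \<open>(4 * L * M / \<mu>)\<^sup>2\<close> in \<open>G_comp\<close>.\<close>
    then have "offset l \<eta> \<kappa> \<le> (L / (\<mu> / (4 * M)))\<^sup>2"
      using \<mu>_pos M_pos by (intro H_superlevel_offset_le) auto
    then have "(\<eta>, \<kappa>) \<in> G_comp g \<sigma> \<rho> L x K A \<phi> t l"
      using S by (simp add: G_comp_iff mult_ac)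
    then show "(\<eta>, \<kappa>) \<in> (\<Union>l\<le>K. G_comp g \<sigma> \<rho> L x K A \<phi> t l)" using l(1) by blast
  qed
qed (auto simp: G_comp_def)

text \<open>A common point has offset at most \<open>\<sigma> * \<Delta>\<close> from both ridges,
  hence at least \<open>\<sigma> * \<Delta>\<close> from every ridge. Then no factor exceeds
  \<open>\<mu> / (4 * M)\<close>, contrary to the strict bound above, even if the pieces
  touch.\<close>

lemma disjoint_G_comp: "disjoint_family_on (G_comp g \<sigma> \<rho> L x K A \<phi> t) {..K}"
  unfolding disjoint_family_on_def
proof (intro ballI impI, rule ccontr)
  fix k l assume kl: "k \<in> {..K}" "l \<in> {..K}" "k \<noteq> l"
    and "G_comp g \<sigma> \<rho> L x K A \<phi> t k \<inter> G_comp g \<sigma> \<rho> L x K A \<phi> t l \<noteq> {}"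
  then obtain \<eta> \<kappa> where k: "(\<eta>, \<kappa>) \<in> G_comp g \<sigma> \<rho> L x K A \<phi> t k"
    and l: "(\<eta>, \<kappa>) \<in> G_comp g \<sigma> \<rho> L x K A \<phi> t l" by auto
  have "offset j \<eta> \<kappa> \<ge> \<sigma> * \<Delta>" if "j \<le> K" for j
    using G_comp_imp_offset_le[OF k] G_comp_imp_offset_le[OF l]
      offset_separated[of j k \<eta> \<kappa>] offset_separated[of j l \<eta> \<kappa>] that kl by (cases "j = k") auto
  then have "cmod (H j \<eta> \<kappa>) \<le> cross_err" if "j \<le> K" for j
    using norm_H_le that by blast
  moreover have "cross_err \<le> \<mu> / (4 * M)"
    using M_cross_err_le M_pos by (simp add: field_simps)
  ultimately have H: "cmod (H j \<eta> \<kappa>) \<le> \<mu> / (4 * M)" if "j \<le> K" for j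
    using that by fastforce
  have "\<mu> / 2 \<le> cmod (S \<eta> \<kappa>)" using k by (simp add: G_comp_iff)
  then show False by (rule G_set_imp_H_ge) (use H in force)
qed

text \<open>On the ridge itself the factor \<open>H l\<close> is 1, so \<open>S\<close> is close to
  the component.\<close>

lemma norm_S_center_ge:
  assumes "l \<le> K"
  shows "cmod (S (\<phi>1 l) (\<phi>2 l)) \<ge> A l t - err_bound c0 N B1 B2 \<Delta> L \<alpha> M"
proof -
  have "H l (\<phi>1 l) (\<phi>2 l) = 1" by (simp add: H_def ghat_0)
  moreover have "offset l (\<phi>1 l) (\<phi>2 l) = 0" by (simp add: offset_def)
  ultimately have "cmod (S (\<phi>1 l) (\<phi>2 l) - component A \<phi> l t) < err_bound c0 N B1 B2 \<Delta> L \<alpha> M"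
    using S_minus_component_less[OF assms, of "\<phi>1 l" "\<phi>2 l"] \<sigma>_pos \<Delta> by simp
  then show ?thesis
    using norm_triangle_sub[of "component A \<phi> l t" "S (\<phi>1 l) (\<phi>2 l)"] norm_component[OF assms]
    by (simp add: norm_minus_commute)
qed

lemma center_in_G_comp:
  assumes "l \<le> K"
  shows "(\<phi>1 l, \<phi>2 l) \<in> G_comp g \<sigma> \<rho> L x K A \<phi> t l"
  using norm_S_center_ge[OF assms] err_bound_le \<mu>_le_A[OF assms]
  by (simp add: G_comp_iff offset_def)

section \<open>Existence of ridge points\<close>

lemma continuous_on_S: "continuous_on UNIV (\<lambda>p. S (fst p) (snd p))"
proof -
  have "continuous_on UNIV (\<lambda>p. (\<sigma> * fst p, \<sigma>\<^sup>2 * snd p))"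
    by (intro continuous_intros)
  from continuous_on_compose2[OF continuous_on_wft[OF continuous_on_x_affine] this]
  show ?thesis unfolding chirplet_eq_wft[OF \<sigma>_pos] by simp
qed

text \<open>For \<open>\<rho> = 0\<close> the set \<open>G_comp\<close> is bounded in the chirp rate only through the decay of the
  chirplet transform itself.\<close>

lemma compact_G_comp: "compact (G_comp g \<sigma> \<rho> L x K A \<phi> t l)"
proof -
  \<comment> \<open>Decay with the constant \<open>C\<close> confines both coordinates, also for
    \<rho> = 0. The ridge \<open>k\<close> with the large factor is not identified with
    \<open>l\<close>, hence the union over all \<open>k\<close>.\<close>
  define R where "R = (C / (\<mu> / (4 * M)))\<^sup>2"
  have "bounded (G_comp g \<sigma> \<rho> L x K A \<phi> t l)"
  proof (rule bounded_subset)
    show "G_comp g \<sigma> \<rho> L x K A \<phi> t l \<subseteq>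
        (\<Union>k\<le>K. cball (\<phi>1 k) (R / \<sigma>) \<times> cball (\<phi>2 k) (R / \<sigma>\<^sup>2))"
    proof clarify
      fix \<eta> \<kappa> assume "(\<eta>, \<kappa>) \<in> G_comp g \<sigma> \<rho> L x K A \<phi> t l"
      then have "\<mu> / 2 \<le> cmod (S \<eta> \<kappa>)" by (simp add: G_comp_iff)
      then obtain k where k: "k \<le> K" "\<mu> / (4 * M) < cmod (H k \<eta> \<kappa>)" by (rule G_set_imp_H_ge)
      then have "\<bar>\<sigma> * (\<eta> - \<phi>1 k)\<bar> + \<bar>\<sigma>\<^sup>2 * (\<kappa> - \<phi>2 k)\<bar> \<le> R"
        unfolding R_def using \<mu>_pos M_pos by (intro ghat_superlevel_le) (simp_all add: H_def)
      then have "\<bar>\<sigma> * (\<eta> - \<phi>1 k)\<bar> \<le> R" "\<bar>\<sigma>\<^sup>2 * (\<kappa> - \<phi>2 k)\<bar> \<le> R" by linarith+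
      then have "\<sigma> * \<bar>\<eta> - \<phi>1 k\<bar> \<le> R" "\<sigma>\<^sup>2 * \<bar>\<kappa> - \<phi>2 k\<bar> \<le> R"
        using \<sigma>_pos by (simp_all add: abs_mult)
      then have "\<eta> \<in> cball (\<phi>1 k) (R / \<sigma>)" "\<kappa> \<in> cball (\<phi>2 k) (R / \<sigma>\<^sup>2)"
        using \<sigma>_pos by (simp_all add: dist_real_def abs_minus_commute pos_le_divide_eq mult.commute)
      then show "(\<eta>, \<kappa>) \<in> (\<Union>k\<le>K. cball (\<phi>1 k) (R / \<sigma>) \<times> cball (\<phi>2 k) (R / \<sigma>\<^sup>2))"
        using k(1) by blast
    qed
  qed (auto intro!: bounded_UN bounded_Times)
  moreover have "closed (G_comp g \<sigma> \<rho> L x K A \<phi> t l)"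
  proof -
    have "G_comp g \<sigma> \<rho> L x K A \<phi> t l =
        {p. \<mu> / 2 \<le> cmod (S (fst p) (snd p))} \<inter> {p. offset l (fst p) (snd p) \<le> (4 * L * M / \<mu>)\<^sup>2}"
      using G_comp_iff by auto
    moreover have "continuous_on UNIV (\<lambda>p. offset l (fst p) (snd p))"
      unfolding offset_def by (intro continuous_intros)
    ultimately show ?thesis
      by (simp only:) (intro closed_Int closed_Collect_le continuous_on_const continuous_on_norm
          continuous_on_S)
  qed
  ultimately show ?thesis by (simp add: compact_eq_bounded_closed)
qed

lemma ex_ridge_point:
  assumes "l \<le> K"
  shows "\<exists>\<eta> \<kappa>. is_ridge_point g \<sigma> \<rho> L x K A \<phi> t l \<eta> \<kappa>"
proof -
  have "continuous_on (G_comp g \<sigma> \<rho> L x K A \<phi> t l) (\<lambda>p. cmod (S (fst p) (snd p)))"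
    by (intro continuous_on_norm continuous_on_subset[OF continuous_on_S]) auto
  from continuous_attains_sup[OF compact_G_comp _ this] center_in_G_comp[OF assms]
  obtain p where "p \<in> G_comp g \<sigma> \<rho> L x K A \<phi> t l"
    "\<And>q. q \<in> G_comp g \<sigma> \<rho> L x K A \<phi> t l \<Longrightarrow> cmod (S (fst q) (snd q)) \<le> cmod (S (fst p) (snd p))"
    by blast
  then have "is_ridge_point g \<sigma> \<rho> L x K A \<phi> t l (fst p) (snd p)"
    unfolding is_ridge_point_def is_arg_max_def by (force simp: not_less)
  then show ?thesis by blast
qed

section \<open>Estimates at a ridge point\<close>

context
  fixes l \<eta> \<kappa>
  assumes l: "l \<le> K" and ridge: "is_ridge_point g \<sigma> \<rho> L x K A \<phi> t l \<eta> \<kappa>"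
begin

lemma ridge_in_G_comp: "(\<eta>, \<kappa>) \<in> G_comp g \<sigma> \<rho> L x K A \<phi> t l"
  using ridge by (simp add: is_ridge_point_def is_arg_max_def)

lemma ridge_S_minus_component_less:
  "cmod (S \<eta> \<kappa> - component A \<phi> l t * H l \<eta> \<kappa>) < err_bound c0 N B1 B2 \<Delta> L \<alpha> M"
  by (rule S_minus_component_less[OF l G_comp_imp_offset_le[OF ridge_in_G_comp]])

text \<open>The centre of ridge \<open>l\<close> competes in the maximisation.\<close>

lemma norm_S_ridge_ge: "A l t - err_bound c0 N B1 B2 \<Delta> L \<alpha> M \<le> cmod (S \<eta> \<kappa>)"
proof -
  have "cmod (S (\<phi>1 l) (\<phi>2 l)) \<le> cmod (S \<eta> \<kappa>)"
    using ridge center_in_G_comp[OF l] unfolding is_ridge_point_def is_arg_max_def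
    by (force simp: not_less)
  then show ?thesis using norm_S_center_ge[OF l] by linarith
qed

lemma norm_S_ridge_le:
  "cmod (S \<eta> \<kappa>) \<le> A l t * cmod (H l \<eta> \<kappa>) + err_bound c0 N B1 B2 \<Delta> L \<alpha> M"
  using ridge_S_minus_component_less norm_triangle_sub[of "S \<eta> \<kappa>" "component A \<phi> l t * H l \<eta> \<kappa>"]
    norm_component[OF l] by (simp add: norm_mult)

lemma ridge_amplitude_error:
  "\<bar>cmod (S \<eta> \<kappa>) - A l t\<bar> \<le> err_bound c0 N B1 B2 \<Delta> L \<alpha> M"
proof -
  have "A l t * cmod (H l \<eta> \<kappa>) \<le> A l t"
    using mult_left_mono[OF norm_ghat_le_1, of "A l t"] A_pos[OF l, of t] by (simp add: H_def)
  then show ?thesis using norm_S_ridge_ge norm_S_ridge_le by linarith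
qed

text \<open>\<open>cmod (S \<eta> \<kappa>)\<close> lies between the lower bound by comparison with
  the centre and the upper bound \<open>A l t * cmod (H l \<eta> \<kappa>)\<close> plus error; solve
  for the modulus of \<open>H\<close>.\<close>

lemma ridge_deficit:
  "1 - cmod (H l \<eta> \<kappa>) \<le> 2 * err_bound c0 N B1 B2 \<Delta> L \<alpha> M / A l t"
  using norm_S_ridge_ge norm_S_ridge_le A_pos[OF l, of t] by (simp add: field_simps)

text \<open>Recovering the component with its phase needs \<open>H\<close> itself near 1, not only
  its modulus.\<close>

lemma ridge_component_error:
  "cmod (S \<eta> \<kappa> - component A \<phi> l t)
    \<le> A l t * cmod (H l \<eta> \<kappa> - 1) + err_bound c0 N B1 B2 \<Delta> L \<alpha> M"
proof -
  let ?c = "component A \<phi> l t"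
  have "cmod (S \<eta> \<kappa> - ?c) \<le> cmod (S \<eta> \<kappa> - ?c * H l \<eta> \<kappa>) + cmod (?c * H l \<eta> \<kappa> - ?c)"
    using norm_triangle_ineq[of "S \<eta> \<kappa> - ?c * H l \<eta> \<kappa>" "?c * H l \<eta> \<kappa> - ?c"] by simp
  moreover have "?c * H l \<eta> \<kappa> - ?c = ?c * (H l \<eta> \<kappa> - 1)" by (simp add: right_diff_distrib)
  then have "cmod (?c * H l \<eta> \<kappa> - ?c) = A l t * cmod (H l \<eta> \<kappa> - 1)"
    by (simp only: norm_mult norm_component[OF l])
  ultimately show ?thesis using ridge_S_minus_component_less by linarith
qed

end

end

section \<open>Assembly of the theorem\<close>

lemma admissible_imp_window:
  assumes "admissible_window g N C"
  shows "window g N C"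
proof (rule window.intro)
  have supp: "closure {\<tau>. g \<tau> \<noteq> 0} \<subseteq> {-N..N}"
    using assms unfolding admissible_window_def by (elim conjE)
  fix s assume "g s \<noteq> 0"
  then have "s \<in> {-N..N}" using closure_subset[of "{\<tau>. g \<tau> \<noteq> 0}"] supp by blast
  then show "\<bar>s\<bar> \<le> N" by auto
next
  fix \<eta> \<kappa> :: real assume "(\<eta>, \<kappa>) \<noteq> (0, 0)"
  then show "cmod (poly_fourier (\<lambda>\<tau>. of_real (g \<tau>)) \<eta> \<kappa>) \<le> C / sqrt (\<bar>\<eta>\<bar> + \<bar>\<kappa>\<bar>)"
    using assms unfolding admissible_window_def by (elim conjE) blast
qed (use assms in \<open>unfold admissible_window_def, elim conjE, blast\<close>)+

theorem theorem1:
  fixes g :: "real \<Rightarrow> real" and N C B1 B2 \<rho> \<Delta> c0 L :: real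
  assumes window: "admissible_window g N C"
    and "B1 > 0" and "B2 > 0" and "\<rho> \<ge> 0" and "\<Delta> > 0" and "c0 > 0"
    and L: "L = window_L \<rho> C"
  shows
    "(\<forall>\<alpha> \<sigma> x K A \<phi> t.
        \<alpha> > 0 \<and> \<sigma> = c0 / \<alpha>\<^sup>2 \<and> class_A \<alpha> B1 B2 \<rho> \<Delta> x K A \<phi> \<and>
        (\<rho> > 0 \<longrightarrow> \<sigma> \<ge> 1) \<and>
        \<alpha> \<le> alpha_max c0 N B1 B2 \<Delta> L (amp_min K A t) (amp_sum K A t)
        \<longrightarrow>
        G_set g \<sigma> x K A t = (\<Union>l\<le>K. G_comp g \<sigma> \<rho> L x K A \<phi> t l) \<and>
        disjoint_family_on (G_comp g \<sigma> \<rho> L x K A \<phi> t) {..K} \<and>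
        (\<forall>l\<le>K. G_comp g \<sigma> \<rho> L x K A \<phi> t l \<noteq> {}) \<and>
        (\<forall>l\<le>K. (\<exists>\<eta> \<kappa>. is_ridge_point g \<sigma> \<rho> L x K A \<phi> t l \<eta> \<kappa>) \<and>
           (\<forall>\<eta> \<kappa>. is_ridge_point g \<sigma> \<rho> L x K A \<phi> t l \<eta> \<kappa> \<longrightarrow>
              \<bar>cmod (chirplet g \<sigma> x t \<eta> \<kappa>) - A l t\<bar>
                \<le> err_bound c0 N B1 B2 \<Delta> L \<alpha> (amp_sum K A t))))
     \<and>
     (\<forall>\<mu>0 M0. \<mu>0 > 0 \<longrightarrow>
        (\<exists>\<omega>. \<omega> \<in> o[at_right (0::real)](\<lambda>_. 1 :: real) \<and>
          (\<forall>\<^sub>F \<alpha> in at_right 0. \<forall>\<sigma> x K A \<phi> t.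
             \<sigma> = c0 / \<alpha>\<^sup>2 \<and> class_A \<alpha> B1 B2 \<rho> \<Delta> x K A \<phi> \<and>
             \<alpha> \<le> alpha_max c0 N B1 B2 \<Delta> L (amp_min K A t) (amp_sum K A t) \<and>
             \<mu>0 \<le> amp_min K A t \<and> amp_sum K A t \<le> M0
             \<longrightarrow>
             (\<forall>l\<le>K. \<forall>\<eta> \<kappa>. is_ridge_point g \<sigma> \<rho> L x K A \<phi> t l \<eta> \<kappa> \<longrightarrow>
                \<bar>\<eta> - deriv (\<phi> l) t\<bar> \<le> 1 / \<sigma> * \<omega> \<alpha> \<and>
                \<bar>\<eta> - deriv (\<phi> l) t\<bar> \<le> \<alpha>\<^sup>2 * \<omega> \<alpha> \<and>
                \<bar>\<kappa> - deriv (deriv (\<phi> l)) t\<bar> \<le> 1 / \<sigma>\<^sup>2 * \<omega> \<alpha> \<and>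
                \<bar>\<kappa> - deriv (deriv (\<phi> l)) t\<bar> \<le> \<alpha> ^ 4 * \<omega> \<alpha> \<and>
                cmod (chirplet g \<sigma> x t \<eta> \<kappa> - component A \<phi> l t)
                  \<le> \<omega> \<alpha> + err_bound c0 N B1 B2 \<Delta> L \<alpha> (amp_sum K A t)))))"
proof (rule conjI; intro allI impI; (elim conjE)?)
  fix \<alpha> \<sigma> x K A \<phi> t
  assume "\<alpha> > 0" "\<sigma> = c0 / \<alpha>\<^sup>2" "class_A \<alpha> B1 B2 \<rho> \<Delta> x K A \<phi>" "\<rho> > 0 \<longrightarrow> \<sigma> \<ge> 1"
    "\<alpha> \<le> alpha_max c0 N B1 B2 \<Delta> L (amp_min K A t) (amp_sum K A t)"
  then interpret chirplet_analysis g N C B1 B2 \<rho> \<Delta> c0 L \<alpha> \<sigma> x K A \<phi> t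
    using assms by (intro chirplet_analysis.intro admissible_imp_window chirplet_analysis_axioms.intro) auto
  show "G_set g \<sigma> x K A t = (\<Union>l\<le>K. G_comp g \<sigma> \<rho> L x K A \<phi> t l) \<and>
        disjoint_family_on (G_comp g \<sigma> \<rho> L x K A \<phi> t) {..K} \<and>
        (\<forall>l\<le>K. G_comp g \<sigma> \<rho> L x K A \<phi> t l \<noteq> {}) \<and>
        (\<forall>l\<le>K. (\<exists>\<eta> \<kappa>. is_ridge_point g \<sigma> \<rho> L x K A \<phi> t l \<eta> \<kappa>) \<and>
           (\<forall>\<eta> \<kappa>. is_ridge_point g \<sigma> \<rho> L x K A \<phi> t l \<eta> \<kappa> \<longrightarrow>
              \<bar>cmod (chirplet g \<sigma> x t \<eta> \<kappa>) - A l t\<bar>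
                \<le> err_bound c0 N B1 B2 \<Delta> L \<alpha> (amp_sum K A t)))"
    using G_set_eq_Union disjoint_G_comp center_in_G_comp ex_ridge_point ridge_amplitude_error
    by blast
next
  fix \<mu>0 M0 :: real assume "\<mu>0 > 0"
  interpret window g N C by (rule admissible_imp_window[OF window])
  \<comment> \<open>\<open>c\<close> is the error bound divided by \<alpha> and \<open>M\<close>.
    With \<open>\<mu>0 \<le> A l t\<close> and \<open>M \<le> M0\<close> the deficit at a ridge
    point is at most \<open>2 * M0 * c / \<mu>0 * \<alpha>\<close>, the rate passed to
    \<open>deficit_modulus\<close>.\<close>
  define c where "c = L / sqrt (c0 * \<Delta>) + c0 * N * B1 + pi / 3 * B2 * c0 ^ 3 * N ^ 3"
  obtain h where h: "(h \<longlongrightarrow> 0) (at_right 0)"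
    and h_le: "\<forall>\<^sub>F \<alpha> in at_right 0. \<forall>\<eta> \<kappa>. 1 - cmod (ghat \<eta> \<kappa>) \<le> (2 * M0 * c / \<mu>0) * \<alpha> \<longrightarrow> \<bar>\<eta>\<bar> + \<bar>\<kappa>\<bar> \<le> h \<alpha>"
    by (rule deficit_modulus)
  define d where "d = 2 * pi * N + pi * N\<^sup>2"
  \<comment> \<open>One function for all five estimates: 1 serves the forms in \<sigma>,
    \<open>1 / c0\<close> and \<open>1 / c0\<^sup>2\<close> the forms in \<alpha>, and
    \<open>M0 * d\<close> the phase error through the Lipschitz constants of
    \<open>ghat\<close>.\<close>
  define \<omega> where "\<omega> \<alpha> = (1 + 1 / c0 + 1 / c0\<^sup>2 + M0 * d) * h \<alpha>" for \<alpha>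
  have "(\<omega> \<longlongrightarrow> 0) (at_right 0)"
    unfolding \<omega>_def using h by (rule tendsto_mult_right_zero)
  then have "\<omega> \<in> o[at_right 0](\<lambda>_. 1)" by (intro smalloI_tendsto) auto
  \<comment> \<open>Below \<open>sqrt c0\<close> the scale \<sigma> exceeds 1, so
    \<open>\<sigma>_ge\<close> holds for all small \<alpha>.\<close>
  moreover have ev: "\<forall>\<^sub>F \<alpha> in at_right 0. \<alpha> \<in> {0<..<sqrt c0}"
    using \<open>c0 > 0\<close> by (intro eventually_at_right_real) simp
  moreover have "\<forall>\<^sub>F \<alpha> in at_right 0. \<forall>\<sigma> x K A \<phi> t.
             \<sigma> = c0 / \<alpha>\<^sup>2 \<and> class_A \<alpha> B1 B2 \<rho> \<Delta> x K A \<phi> \<and>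
             \<alpha> \<le> alpha_max c0 N B1 B2 \<Delta> L (amp_min K A t) (amp_sum K A t) \<and>
             \<mu>0 \<le> amp_min K A t \<and> amp_sum K A t \<le> M0
             \<longrightarrow>
             (\<forall>l\<le>K. \<forall>\<eta> \<kappa>. is_ridge_point g \<sigma> \<rho> L x K A \<phi> t l \<eta> \<kappa> \<longrightarrow>
                \<bar>\<eta> - deriv (\<phi> l) t\<bar> \<le> 1 / \<sigma> * \<omega> \<alpha> \<and>
                \<bar>\<eta> - deriv (\<phi> l) t\<bar> \<le> \<alpha>\<^sup>2 * \<omega> \<alpha> \<and>
                \<bar>\<kappa> - deriv (deriv (\<phi> l)) t\<bar> \<le> 1 / \<sigma>\<^sup>2 * \<omega> \<alpha> \<and>
                \<bar>\<kappa> - deriv (deriv (\<phi> l)) t\<bar> \<le> \<alpha> ^ 4 * \<omega> \<alpha> \<and>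
                cmod (chirplet g \<sigma> x t \<eta> \<kappa> - component A \<phi> l t)
                  \<le> \<omega> \<alpha> + err_bound c0 N B1 B2 \<Delta> L \<alpha> (amp_sum K A t))"
  proof (rule eventually_mono[OF eventually_conj[OF h_le ev]], intro allI impI, elim conjE)
    fix \<alpha> \<sigma> x K A \<phi> t l \<eta> \<kappa>
    assume hle: "\<forall>\<eta> \<kappa>. 1 - cmod (ghat \<eta> \<kappa>) \<le> 2 * M0 * c / \<mu>0 * \<alpha> \<longrightarrow> \<bar>\<eta>\<bar> + \<bar>\<kappa>\<bar> \<le> h \<alpha>"
      and \<alpha>: "\<alpha> \<in> {0<..<sqrt c0}" and \<sigma>: "\<sigma> = c0 / \<alpha>\<^sup>2"
      and hyps: "class_A \<alpha> B1 B2 \<rho> \<Delta> x K A \<phi>"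
        "\<alpha> \<le> alpha_max c0 N B1 B2 \<Delta> L (amp_min K A t) (amp_sum K A t)"
      and \<mu>0: "\<mu>0 \<le> amp_min K A t" and M0: "amp_sum K A t \<le> M0"
      and l: "l \<le> K" and ridge: "is_ridge_point g \<sigma> \<rho> L x K A \<phi> t l \<eta> \<kappa>"
    have "\<alpha>\<^sup>2 \<le> (sqrt c0)\<^sup>2" using \<alpha> by (intro power_mono) auto
    then have "\<sigma> \<ge> 1" using \<sigma> \<alpha> \<open>c0 > 0\<close> by simp
    then interpret chirplet_analysis g N C B1 B2 \<rho> \<Delta> c0 L \<alpha> \<sigma> x K A \<phi> t
      using assms hyps \<alpha> \<sigma>
      by (intro chirplet_analysis.intro admissible_imp_window chirplet_analysis_axioms.intro) auto
    let ?a = "\<sigma> * (\<eta> - \<phi>1 l)" and ?b = "\<sigma>\<^sup>2 * (\<kappa> - \<phi>2 l)"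
    have "c > 0" unfolding c_def using L_pos c0 \<Delta> B1 B2 N_pos
      by (intro add_pos_pos mult_pos_pos divide_pos_pos) auto
    have "1 - cmod (ghat ?a ?b) \<le> 2 * (\<alpha> * M * c) / A l t"
      using ridge_deficit[OF l ridge] by (simp add: H_def err_bound_def c_def)
    also have "\<dots> \<le> 2 * (\<alpha> * M0 * c) / \<mu>0"
      using \<open>c > 0\<close> \<open>\<mu>0 > 0\<close> \<mu>0 M0 \<mu>_le_A[OF l] M_pos local.\<alpha>
      by (intro frac_le mult_left_mono mult_right_mono) auto
    finally have "1 - cmod (ghat ?a ?b) \<le> 2 * M0 * c / \<mu>0 * \<alpha>" by (simp add: mult_ac)
    then have ab: "\<bar>?a\<bar> + \<bar>?b\<bar> \<le> h \<alpha>" using hle by blast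
    \<comment> \<open>The sign of \<open>h \<alpha>\<close> is read off from the ridge point at
      hand; it makes the bounds monotone in their coefficients.\<close>
    have h0: "h \<alpha> \<ge> 0" using ab by linarith
    have d0: "d \<ge> 0" using N_pos by (simp add: d_def)
    have Md0: "M0 * d \<ge> 0" using M_pos M0 d0 by simp
    have le_\<omega>: "r * h \<alpha> \<le> \<omega> \<alpha>" if "r \<in> {1, 1 / c0, 1 / c0\<^sup>2, M0 * d}" for r
      unfolding \<omega>_def using that c0 Md0 by (intro mult_right_mono h0) auto
    have "\<bar>?a\<bar> \<le> h \<alpha>" "\<bar>?b\<bar> \<le> h \<alpha>" using ab by linarith+
    then have a: "\<sigma> * \<bar>\<eta> - \<phi>1 l\<bar> \<le> h \<alpha>" and b: "\<sigma>\<^sup>2 * \<bar>\<kappa> - \<phi>2 l\<bar> \<le> h \<alpha>"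
      using \<sigma>_pos by (simp_all add: abs_mult)
    have "cmod (S \<eta> \<kappa> - component A \<phi> l t)
        \<le> A l t * cmod (ghat ?a ?b - 1) + err_bound c0 N B1 B2 \<Delta> L \<alpha> M"
      using ridge_component_error[OF l ridge] by (simp add: H_def)
    also have "A l t * cmod (ghat ?a ?b - 1) \<le> M0 * (d * h \<alpha>)"
    proof (rule mult_mono)
      show "A l t \<le> M0" using A_le_M[OF l] M0 by simp
      have "cmod (ghat ?a ?b - 1) \<le> 2 * pi * N * \<bar>?a\<bar> + pi * N\<^sup>2 * \<bar>?b\<bar>"
        by (rule norm_ghat_minus_1_le)
      also have "\<dots> \<le> 2 * pi * N * h \<alpha> + pi * N\<^sup>2 * h \<alpha>"
        using ab N_pos by (intro add_mono mult_left_mono) auto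
      also have "\<dots> = d * h \<alpha>" by (simp add: d_def algebra_simps)
      finally show "cmod (ghat ?a ?b - 1) \<le> d * h \<alpha>" .
    qed (use M_pos M0 in auto)
    also have "M0 * (d * h \<alpha>) \<le> \<omega> \<alpha>" using le_\<omega>[of "M0 * d"] by simp
    finally have err: "cmod (S \<eta> \<kappa> - component A \<phi> l t)
        \<le> \<omega> \<alpha> + err_bound c0 N B1 B2 \<Delta> L \<alpha> M" by simp
    have "\<bar>\<eta> - \<phi>1 l\<bar> \<le> 1 / \<sigma> * h \<alpha>" "\<bar>\<kappa> - \<phi>2 l\<bar> \<le> 1 / \<sigma>\<^sup>2 * h \<alpha>"
      using a b \<sigma>_pos by (simp_all add: field_simps)
    moreover have "1 / \<sigma> * h \<alpha> \<le> 1 / \<sigma> * \<omega> \<alpha>" "1 / \<sigma>\<^sup>2 * h \<alpha> \<le> 1 / \<sigma>\<^sup>2 * \<omega> \<alpha>"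
      using le_\<omega>[of 1] \<sigma>_pos by (auto intro!: divide_right_mono)
    moreover have "1 / \<sigma> * h \<alpha> = \<alpha>\<^sup>2 * (1 / c0 * h \<alpha>)" "1 / \<sigma>\<^sup>2 * h \<alpha> = \<alpha> ^ 4 * (1 / c0\<^sup>2 * h \<alpha>)"
      by (simp_all add: \<sigma> power_divide flip: power_mult)
    moreover have "\<alpha>\<^sup>2 * (1 / c0 * h \<alpha>) \<le> \<alpha>\<^sup>2 * \<omega> \<alpha>" "\<alpha> ^ 4 * (1 / c0\<^sup>2 * h \<alpha>) \<le> \<alpha> ^ 4 * \<omega> \<alpha>"
      by (intro mult_left_mono le_\<omega>; simp)+
    ultimately show "\<bar>\<eta> - \<phi>1 l\<bar> \<le> 1 / \<sigma> * \<omega> \<alpha> \<and> \<bar>\<eta> - \<phi>1 l\<bar> \<le> \<alpha>\<^sup>2 * \<omega> \<alpha> \<and>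
        \<bar>\<kappa> - \<phi>2 l\<bar> \<le> 1 / \<sigma>\<^sup>2 * \<omega> \<alpha> \<and> \<bar>\<kappa> - \<phi>2 l\<bar> \<le> \<alpha> ^ 4 * \<omega> \<alpha> \<and>
        cmod (S \<eta> \<kappa> - component A \<phi> l t) \<le> \<omega> \<alpha> + err_bound c0 N B1 B2 \<Delta> L \<alpha> M"
      using err by linarith
  qed
  ultimately show "\<exists>\<omega>. \<omega> \<in> o[at_right (0::real)](\<lambda>_. 1 :: real) \<and>
          (\<forall>\<^sub>F \<alpha> in at_right 0. \<forall>\<sigma> x K A \<phi> t.
             \<sigma> = c0 / \<alpha>\<^sup>2 \<and> class_A \<alpha> B1 B2 \<rho> \<Delta> x K A \<phi> \<and>
             \<alpha> \<le> alpha_max c0 N B1 B2 \<Delta> L (amp_min K A t) (amp_sum K A t) \<and>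
             \<mu>0 \<le> amp_min K A t \<and> amp_sum K A t \<le> M0
             \<longrightarrow>
             (\<forall>l\<le>K. \<forall>\<eta> \<kappa>. is_ridge_point g \<sigma> \<rho> L x K A \<phi> t l \<eta> \<kappa> \<longrightarrow>
                \<bar>\<eta> - deriv (\<phi> l) t\<bar> \<le> 1 / \<sigma> * \<omega> \<alpha> \<and>
                \<bar>\<eta> - deriv (\<phi> l) t\<bar> \<le> \<alpha>\<^sup>2 * \<omega> \<alpha> \<and>
                \<bar>\<kappa> - deriv (deriv (\<phi> l)) t\<bar> \<le> 1 / \<sigma>\<^sup>2 * \<omega> \<alpha> \<and>
                \<bar>\<kappa> - deriv (deriv (\<phi> l)) t\<bar> \<le> \<alpha> ^ 4 * \<omega> \<alpha> \<and>
                cmod (chirplet g \<sigma> x t \<eta> \<kappa> - component A \<phi> l t)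
                  \<le> \<omega> \<alpha> + err_bound c0 N B1 B2 \<Delta> L \<alpha> (amp_sum K A t)))"
    by blast
qed

end
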